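(* Let $f=\bigoplus_{\ell\in A}a_\ell w^\ell\in\mathbb{TR}[w_1,\ldots,w_n]$ be a tropical polynomial with signs, where $A\subseteq\mathbb{N}^n$ is finite and $\langle A\rangle=\mathbb{Z}^n$. The set of tropical singularities (singular points) of $\mathcal{T}_{\mathbb{R}}(f)$ is $$\bigcap_{L}\mathcal{T}_{\mathbb{R}}\left(\frac{\partial f}{\partial L}\right),$$ where $L$ runs over all nonzero affine functions $L=b_0+b_1w_1+\cdots+b_nw_n$ with integer coefficients.
   Context: $\mathbb{K}=\bigcup_{m\ge1}\mathbb{R}((t^{1/m}))$ is the real closed field of real Puiseux series; the valuation $v(x)\in\mathbb{Q}$ of $x\in\mathbb{K}^*$ is the least exponent of $t$ occurring in $x$, and $x>0$ iff the coefficient of its least-exponent term is positive. Put $\mathbb{TR}=\{1,-1\}\times\mathbb{R}$ and $trop:\mathbb{K}^*\to\mathbb{TR}$, $trop(x)=(s(x),v(x))$ with $s(x)=\pm1$ the sign of $x$; $trop$ is applied component-wise to points all of whose coordinates are nonzero. For $a=(\sigma,\alpha)\in\mathbb{TR}$ write $s(a)=\sigma$ (sign) and $|a|=\alpha$ (modulus); for $p\in\mathbb{TR}^n$, $|p|=(|p_1|,\ldots,|p_n|)$. A sign $\epsilon\in\{1,-1\}$ acts by $\epsilon\,(\sigma,\alpha)=(\epsilon\sigma,\alpha)$. A tropical polynomial with signs (real tropical polynomial) is a formal sum $f=\bigoplus_{\ell\in A}a_\ell w^\ell$ with $A\subseteq\mathbb{N}^n$ finite and $a_\ell\in\mathbb{TR}$.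 The real tropical hypersurface $\mathcal{T}_{\mathbb{R}}(f)\subseteq\mathbb{TR}^n$ is the set of points $p=(p_1,\ldots,p_n)$ for which there are two exponents $i\neq j$ in $A$, both attaining $\min_{\ell\in A}\big(|a_\ell|+\langle \ell,|p|\rangle\big)$, such that $s(a_i)\prod_{k=1}^n s(p_k)^{i_k}=1$ and $s(a_j)\prod_{k=1}^n s(p_k)^{j_k}=-1$. For $F=\sum_{\ell\in A}c_\ell x^\ell\in\mathbb{K}[x_1,\ldots,x_n]$ with all $c_\ell\neq0$, $trop(F)=\bigoplus_{\ell\in A}trop(c_\ell)w^\ell$. $\langle A\rangle$ denotes the affine lattice generated by $A$ (integer combinations with coefficients summing to $1$). Euler derivative: $\dfrac{\partial f}{\partial L}=\bigoplus_{\ell\in A,\ L(\ell)\neq0}s(L(\ell))\,a_\ell\,w^\ell$, where $s(L(\ell))=\pm1$ is the sign of the integer $L(\ell)$. (Monomials at which $L$ vanishes are removed, and signs are swapped at monomials where $L$ is negative.) Singular points: a point $p\in\mathcal{T}_{\mathbb{R}}(f)$ is a singular point of $f$ (a tropical singularity of $\mathcal{T}_{\mathbb{R}}(f)$) if there exist $F\in\mathbb{K}[x_1,\ldots,x_n]$ and $P\in\mathbb{K}^n$ such that $P$ is a singular point of $\{F=0\}$ (i.e. $F(P)=0$ and $\frac{\partial F}{\partial x_k}(P)=0$ for all $k$), $trop(F)=f$ and $trop(P)=p$.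
   Formalization: Valuations of real Puiseux series are rational, so the claim fails as stated at irrational moduli; here the coefficients of f are assumed to have rational moduli and the intersection is restricted to points p all of whose moduli are rational. *)

theory Defs
  imports
    "HOL-Analysis.Finite_Cartesian_Product"
    "HOL-Library.Poly_Mapping"
    "HOL-Computational_Algebra.Formal_Laurent_Series"
begin

unbundle fps_syntax

section \<open>The field of real Puiseux series\<close>

text \<open>
  \<open>ramified_nth m g q\<close> is the coefficient of \<open>t\<close> to the power \<open>q\<close> in \<open>g(t\<^sup>1\<^sup>/\<^sup>m)\<close>.
  A Puiseux series is represented by its coefficient function on the rational exponents, so that
  the carrier below is literally the union over \<open>m \<ge> 1\<close> of the Laurent series in \<open>t\<^sup>1\<^sup>/\<^sup>m\<close>.
\<close>

definition ramified_nth :: "nat \<Rightarrow> real fls \<Rightarrow> rat \<Rightarrow> real" where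
  "ramified_nth m g q = (if of_nat m * q \<in> \<int> then g $$ \<lfloor>of_nat m * q\<rfloor> else 0)"

typedef puiseux = "\<Union>m\<in>{1..}. range (ramified_nth m)"
  morphisms puiseux_nth Abs_puiseux
  by blast

definition ramify :: "nat \<Rightarrow> real fls \<Rightarrow> puiseux" where
  "ramify m g = Abs_puiseux (ramified_nth m g)"

lemma puiseux_nth_ramify: "m > 0 \<Longrightarrow> puiseux_nth (ramify m g) = ramified_nth m g"
  unfolding ramify_def by (rule Abs_puiseux_inverse, rule UN_I[of m]) auto

lemma ramified_nth_frac [simp]:
  assumes "m > 0"
  shows "ramified_nth m g (of_int i / of_nat m) = g $$ i"
  using assms by (simp add: ramified_nth_def)

lemma ramified_nth_nonzeroE:
  assumes "ramified_nth m g q \<noteq> 0" "m > 0"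
  obtains i where "q = of_int i / of_nat m" "g $$ i \<noteq> 0"
proof -
  from assms have "of_nat m * q \<in> \<int>" by (auto simp: ramified_nth_def split: if_splits)
  then obtain i where i: "of_nat m * q = of_int i" by (auto elim: Ints_cases)
  then have "q = of_int i / of_nat m" using assms(2) by (simp add: field_simps)
  moreover from this have "g $$ i \<noteq> 0" using assms by simp
  ultimately show ?thesis by (rule that)
qed

lemma ramified_nth_compose_power:
  assumes "m > 0" "k > 0"
  shows "ramified_nth (m * k) (fls_compose_power g k) = ramified_nth m g"
proof
  fix q :: rat
  show "ramified_nth (m * k) (fls_compose_power g k) q = ramified_nth m g q"
  proof (cases "of_nat (m * k) * q \<in> \<int>")
    case True
    then obtain i where i: "of_nat (m * k) * q = of_int i" by (auto elim: Ints_cases)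
    then have q: "q = of_int i / of_nat (m * k)" using assms by (simp add: field_simps)
    show ?thesis
    proof (cases "int k dvd i")
      case True
      then obtain j where j: "i = int k * j" by auto
      have qj: "q = of_int j / of_nat m" using assms by (simp add: q j)
      have "ramified_nth (m * k) (fls_compose_power g k) q = fls_compose_power g k $$ i"
        unfolding q using assms by (intro ramified_nth_frac) simp
      also have "\<dots> = g $$ j" using assms by (simp add: fls_nth_compose_power j)
      also have "\<dots> = ramified_nth m g q" unfolding qj using assms by simp
      finally show ?thesis .
    next
      case False
      have "ramified_nth (m * k) (fls_compose_power g k) q = fls_compose_power g k $$ i"
        unfolding q using assms by (intro ramified_nth_frac) simp
      also have "\<dots> = 0" using assms False by (simp add: fls_nth_compose_power)
      also have "ramified_nth m g q = 0"
      proof (rule ccontr)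
        assume "ramified_nth m g q \<noteq> 0"
        then obtain j where "q = of_int j / of_nat m" using assms(1) ramified_nth_nonzeroE by metis
        then have "(of_int i :: rat) = of_int (int k * j)" using q assms by (simp add: field_simps)
        then have "i = int k * j" by (simp only: of_int_eq_iff)
        then show False using False by simp
      qed
      finally show ?thesis by simp
    qed
  next
    case False
    have "of_nat m * q \<notin> \<int>"
    proof
      assume "of_nat m * q \<in> \<int>"
      then have "of_nat k * (of_nat m * q) \<in> \<int>" using Ints_mult Ints_of_nat by blast
      then show False using False by (simp add: mult_ac)
    qed
    then show ?thesis using False by (simp add: ramified_nth_def)
  qed
qed

lemma ramify_compose_power:
  "m > 0 \<Longrightarrow> k > 0 \<Longrightarrow> ramify (m * k) (fls_compose_power g k) = ramify m g"
  by (simp add: ramify_def ramified_nth_compose_power)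

lemma puiseux_cases:
  obtains m g where "m > 0" "x = ramify m g"
proof -
  have "puiseux_nth x \<in> (\<Union>m\<in>{1..}. range (ramified_nth m))" by (rule puiseux_nth)
  then obtain m g where mg: "m \<ge> 1" "puiseux_nth x = ramified_nth m g" by auto
  then have "x = ramify m g"
    unfolding ramify_def by (metis puiseux_nth_inverse)
  then show ?thesis using mg that[of m g] by simp
qed

lemma puiseux_cases2:
  obtains m g h where "m > 0" "x = ramify m g" "y = ramify m h"
proof -
  obtain m g where 1: "m > 0" "x = ramify m g" by (rule puiseux_cases)
  obtain k h where 2: "k > 0" "y = ramify k h" by (rule puiseux_cases)
  show ?thesis
    by (rule that[of "m * k" "fls_compose_power g k" "fls_compose_power h m"])
      (use 1 2 in \<open>simp_all add: ramify_compose_power ramify_compose_power[of k m h, unfolded mult.commute[of k m]]\<close>)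
qed

lemma puiseux_cases3:
  obtains m g h l where "m > 0" "x = ramify m g" "y = ramify m h" "z = ramify m l"
proof -
  obtain m g h where 1: "m > 0" "x = ramify m g" "y = ramify m h" by (rule puiseux_cases2)
  obtain k l where 2: "k > 0" "z = ramify k l" by (rule puiseux_cases)
  show ?thesis
    by (rule that[of "m * k" "fls_compose_power g k" "fls_compose_power h k" "fls_compose_power l m"])
      (use 1 2 in \<open>simp_all add: ramify_compose_power ramify_compose_power[of k m l, unfolded mult.commute[of k m]]\<close>)
qed

lemma ramify_eq_iff:
  assumes "m > 0"
  shows "ramify m g = ramify m h \<longleftrightarrow> g = h"
proof
  assume eq: "ramify m g = ramify m h"
  show "g = h"
  proof (rule fls_eqI)
    fix i
    have "ramified_nth m g (of_int i / of_nat m) = ramified_nth m h (of_int i / of_nat m)"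
      using eq assms by (metis puiseux_nth_ramify)
    then show "g $$ i = h $$ i" using assms by simp
  qed
qed simp

instantiation puiseux :: "{zero, one, plus, minus, uminus, times}"
begin

definition zero_puiseux :: puiseux where
  "0 = Abs_puiseux (\<lambda>q. 0)"

definition one_puiseux :: puiseux where
  "1 = Abs_puiseux (\<lambda>q. if q = 0 then 1 else 0)"

definition plus_puiseux :: "puiseux \<Rightarrow> puiseux \<Rightarrow> puiseux" where
  "x + y = Abs_puiseux (\<lambda>q. puiseux_nth x q + puiseux_nth y q)"

definition minus_puiseux :: "puiseux \<Rightarrow> puiseux \<Rightarrow> puiseux" where
  "x - y = Abs_puiseux (\<lambda>q. puiseux_nth x q - puiseux_nth y q)"

definition uminus_puiseux :: "puiseux \<Rightarrow> puiseux" where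
  "- x = Abs_puiseux (\<lambda>q. - puiseux_nth x q)"

text \<open>The index set of the sum is finite because the supports are discrete and bounded below.\<close>

definition times_puiseux :: "puiseux \<Rightarrow> puiseux \<Rightarrow> puiseux" where
  "x * y = Abs_puiseux (\<lambda>q. \<Sum>r | puiseux_nth x r \<noteq> 0 \<and> puiseux_nth y (q - r) \<noteq> 0.
                               puiseux_nth x r * puiseux_nth y (q - r))"

instance ..

end

lemma ramify_0: "m > 0 \<Longrightarrow> ramify m 0 = 0"
  unfolding zero_puiseux_def ramify_def
  by (rule arg_cong[of _ _ Abs_puiseux]) (auto simp: ramified_nth_def)

lemma ramify_1:
  assumes "m > 0"
  shows "ramify m 1 = 1"
proof -
  have "ramified_nth m 1 = (\<lambda>q. if q = 0 then 1 else 0)"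
  proof
    fix q
    show "ramified_nth m 1 q = (if q = 0 then 1 else 0)"
    proof (cases "ramified_nth m 1 q = 0")
      case True
      then show ?thesis by (auto simp: ramified_nth_def)
    next
      case False
      then obtain i where "q = of_int i / of_nat m" "(1 :: real fls) $$ i \<noteq> 0"
        using assms ramified_nth_nonzeroE by metis
      then show ?thesis using assms by (auto split: if_splits)
    qed
  qed
  then show ?thesis by (simp add: one_puiseux_def ramify_def)
qed

lemma ramify_add:
  assumes "m > 0"
  shows "ramify m (g + h) = ramify m g + ramify m h"
  unfolding plus_puiseux_def puiseux_nth_ramify[OF assms] unfolding ramify_def
  by (rule arg_cong[of _ _ Abs_puiseux]) (auto simp: ramified_nth_def)

lemma ramify_diff:
  assumes "m > 0"
  shows "ramify m (g - h) = ramify m g - ramify m h"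
  unfolding minus_puiseux_def puiseux_nth_ramify[OF assms] unfolding ramify_def
  by (rule arg_cong[of _ _ Abs_puiseux]) (auto simp: ramified_nth_def)

lemma ramify_uminus:
  assumes "m > 0"
  shows "ramify m (- g) = - ramify m g"
  unfolding uminus_puiseux_def puiseux_nth_ramify[OF assms] unfolding ramify_def
  by (rule arg_cong[of _ _ Abs_puiseux]) (auto simp: ramified_nth_def)

lemma ramify_mult:
  assumes m: "m > 0"
  shows "ramify m (g * h) = ramify m g * ramify m h"
proof -
  define S where "S q = {r. ramified_nth m g r \<noteq> 0 \<and> ramified_nth m h (q - r) \<noteq> 0}" for q
  have "ramified_nth m (g * h) q
        = (\<Sum>r\<in>S q. ramified_nth m g r * ramified_nth m h (q - r))" for q
  proof (cases "of_nat m * q \<in> \<int>")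
    case False
    have "S q = {}"
    proof (rule ccontr)
      assume "S q \<noteq> {}"
      then obtain r where "ramified_nth m g r \<noteq> 0" "ramified_nth m h (q - r) \<noteq> 0"
        by (auto simp: S_def)
      then have "of_nat m * r \<in> \<int>" "of_nat m * (q - r) \<in> \<int>"
        by (auto simp: ramified_nth_def split: if_splits)
      then have "of_nat m * r + of_nat m * (q - r) \<in> \<int>" by (rule Ints_add)
      then show False using False by (simp add: algebra_simps)
    qed
    then show ?thesis using False by (simp add: ramified_nth_def)
  next
    case True
    then obtain N where N: "of_nat m * q = of_int N" by (auto elim: Ints_cases)
    then have q: "q = of_int N / of_nat m" using m by (simp add: field_simps)
    let ?\<phi> = "\<lambda>i::int. of_int i / (of_nat m :: rat)"
    let ?I = "{i. g $$ i \<noteq> 0 \<and> h $$ (N - i) \<noteq> 0}"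
    have qd: "q - ?\<phi> i = ?\<phi> (N - i)" for i by (simp add: q diff_divide_distrib)
    have inj: "inj_on ?\<phi> ?I" using m by (auto simp: inj_on_def)
    have img: "S q = ?\<phi> ` ?I"
    proof (intro equalityI subsetI)
      fix r assume "r \<in> S q"
      then have r: "ramified_nth m g r \<noteq> 0" "ramified_nth m h (q - r) \<noteq> 0" by (auto simp: S_def)
      from r(1) m obtain i where i: "r = ?\<phi> i" "g $$ i \<noteq> 0" by (rule ramified_nth_nonzeroE)
      have "ramified_nth m h (q - r) = h $$ (N - i)"
        unfolding i(1) qd using m by (rule ramified_nth_frac)
      then have "h $$ (N - i) \<noteq> 0" using r(2) by simp
      with i show "r \<in> ?\<phi> ` ?I" by auto
    next
      fix r assume "r \<in> ?\<phi> ` ?I"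
      then obtain i where i: "r = ?\<phi> i" "g $$ i \<noteq> 0" "h $$ (N - i) \<noteq> 0" by auto
      have "ramified_nth m g r \<noteq> 0" using i m by simp
      moreover have "ramified_nth m h (q - r) = h $$ (N - i)"
        unfolding i(1) qd using m by (rule ramified_nth_frac)
      ultimately show "r \<in> S q" using i(3) by (simp add: S_def)
    qed
    have "(\<Sum>r\<in>S q. ramified_nth m g r * ramified_nth m h (q - r))
          = (\<Sum>i\<in>?I. g $$ i * h $$ (N - i))"
      unfolding img sum.reindex[OF inj] o_def qd using m by (simp only: ramified_nth_frac)
    also have "\<dots> = (\<Sum>i=fls_subdegree g..N - fls_subdegree h. g $$ i * h $$ (N - i))"
    proof (rule sum.mono_neutral_left)
      show "?I \<subseteq> {fls_subdegree g..N - fls_subdegree h}"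
        using fls_subdegree_leI by fastforce
    qed auto
    also have "\<dots> = (g * h) $$ N" by (simp add: fls_times_nth(2))
    also have "\<dots> = ramified_nth m (g * h) q" unfolding q using m by simp
    finally show ?thesis by simp
  qed
  then show ?thesis
    unfolding times_puiseux_def puiseux_nth_ramify[OF m] S_def[symmetric] unfolding ramify_def
    by (intro arg_cong[of _ _ Abs_puiseux]) (rule ext)
qed

instance puiseux :: comm_ring_1
proof
  fix a b c :: puiseux
  show "a * b * c = a * (b * c)"
    by (rule puiseux_cases3[of a b c]) (simp flip: ramify_mult add: mult_ac)
  show "a * b = b * a"
    by (rule puiseux_cases2[of a b]) (simp flip: ramify_mult add: mult_ac)
  show "1 * a = a"
  proof (rule puiseux_cases[of a])
    fix m g assume "m > 0" "a = ramify m g"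
    then show "1 * a = a" by (metis ramify_1 ramify_mult mult_1)
  qed
  show "a + b + c = a + (b + c)"
    by (rule puiseux_cases3[of a b c]) (simp flip: ramify_add add: add_ac)
  show "a + b = b + a"
    by (rule puiseux_cases2[of a b]) (simp flip: ramify_add add: add_ac)
  show "0 + a = a"
  proof (rule puiseux_cases[of a])
    fix m g assume "m > 0" "a = ramify m g"
    then show "0 + a = a" by (metis ramify_0 ramify_add add_0)
  qed
  show "- a + a = 0"
  proof (rule puiseux_cases[of a])
    fix m g assume "m > 0" "a = ramify m g"
    then show "- a + a = 0" by (metis ramify_0 ramify_add ramify_uminus left_minus)
  qed
  show "a - b = a + - b"
    by (rule puiseux_cases2[of a b])
      (simp flip: ramify_add ramify_uminus ramify_diff)
  show "(a + b) * c = a * c + b * c"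
    by (rule puiseux_cases3[of a b c])
      (simp flip: ramify_mult ramify_add add: distrib_right)
  show "(0 :: puiseux) \<noteq> 1"
    using ramify_eq_iff[of 1 0 1] ramify_0[of 1] ramify_1[of 1] by simp
qed

lemma ramify_eq_0_iff: "m > 0 \<Longrightarrow> ramify m g = 0 \<longleftrightarrow> g = 0"
  using ramify_eq_iff[of m g 0] ramify_0 by simp

instantiation puiseux :: field
begin

definition inverse_puiseux :: "puiseux \<Rightarrow> puiseux" where
  "inverse (x :: puiseux) = (if x = 0 then 0 else THE y. y * x = 1)"

definition divide_puiseux :: "puiseux \<Rightarrow> puiseux \<Rightarrow> puiseux" where
  "x div y = (x :: puiseux) * inverse y"

instance
proof
  fix a b :: puiseux
  show "inverse a * a = 1" if "a \<noteq> 0"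
  proof -
    obtain m g where mg: "m > 0" "a = ramify m g" by (rule puiseux_cases)
    then have "g \<noteq> 0" using that by (auto simp: ramify_0)
    then have *: "ramify m (inverse g) * a = 1"
      using mg by (simp flip: ramify_mult add: ramify_1)
    have "\<exists>!y. y * a = 1"
    proof
      show "ramify m (inverse g) * a = 1" by (rule *)
      show "y = ramify m (inverse g)" if "y * a = 1" for y
        by (metis that * mult.assoc mult.commute mult_1)
    qed
    from theI'[OF this] show ?thesis using that by (simp add: inverse_puiseux_def)
  qed
  show "a div b = a * inverse b" by (rule divide_puiseux_def)
  show "inverse (0 :: puiseux) = 0" by (simp add: inverse_puiseux_def)
qed

end

definition puiseux_val :: "puiseux \<Rightarrow> rat" where
  "puiseux_val x = (LEAST q. puiseux_nth x q \<noteq> 0)"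

definition puiseux_lead_coeff :: "puiseux \<Rightarrow> real" where
  "puiseux_lead_coeff x = (if x = 0 then 0 else puiseux_nth x (puiseux_val x))"

lemma puiseux_val_ramify:
  assumes "m > 0" "g \<noteq> 0"
  shows "puiseux_val (ramify m g) = of_int (fls_subdegree g) / of_nat m"
  unfolding puiseux_val_def puiseux_nth_ramify[OF assms(1)]
proof (rule Least_equality)
  show "ramified_nth m g (of_int (fls_subdegree g) / of_nat m) \<noteq> 0"
    using assms by simp
next
  fix q assume "ramified_nth m g q \<noteq> 0"
  then obtain i where i: "q = of_int i / of_nat m" "g $$ i \<noteq> 0"
    using assms(1) by (rule ramified_nth_nonzeroE)
  from i(2) have "fls_subdegree g \<le> i" by (rule fls_subdegree_leI)
  then show "of_int (fls_subdegree g) / of_nat m \<le> q" 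
    unfolding i(1) by (intro divide_right_mono) auto
qed

lemma puiseux_lead_coeff_ramify:
  assumes "m > 0"
  shows "puiseux_lead_coeff (ramify m g) = g $$ fls_subdegree g"
  using assms
  by (cases "g = 0")
    (simp_all add: puiseux_lead_coeff_def ramify_eq_0_iff puiseux_val_ramify puiseux_nth_ramify)

lemma puiseux_lead_coeff_0 [simp]: "puiseux_lead_coeff 0 = 0"
  by (simp add: puiseux_lead_coeff_def)

lemma puiseux_lead_coeff_eq_0_iff [simp]: "puiseux_lead_coeff x = 0 \<longleftrightarrow> x = 0"
  by (rule puiseux_cases[of x]) (simp add: puiseux_lead_coeff_ramify ramify_eq_0_iff nth_fls_subdegree_zero_iff)

lemma puiseux_lead_coeff_uminus [simp]: "puiseux_lead_coeff (- x) = - puiseux_lead_coeff x"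
  by (rule puiseux_cases[of x]) (simp flip: ramify_uminus add: puiseux_lead_coeff_ramify)

lemma puiseux_lead_coeff_mult:
  "puiseux_lead_coeff (x * y) = puiseux_lead_coeff x * puiseux_lead_coeff y"
proof (rule puiseux_cases2[of x y])
  fix m g h assume m: "m > 0" and xy: "x = ramify m g" "y = ramify m h"
  show ?thesis
    unfolding xy ramify_mult[OF m, symmetric] puiseux_lead_coeff_ramify[OF m]
    by (cases "g = 0 \<or> h = 0") auto
qed

lemma puiseux_lead_coeff_add_pos:
  assumes "puiseux_lead_coeff x > 0" "puiseux_lead_coeff y > 0"
  shows "puiseux_lead_coeff (x + y) > 0"
proof (rule puiseux_cases2[of x y])
  fix m g h assume m: "m > 0" and xy: "x = ramify m g" "y = ramify m h"
  define d where "d = min (fls_subdegree g) (fls_subdegree h)"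
  have g: "g $$ fls_subdegree g > 0" and h: "h $$ fls_subdegree h > 0"
    using assms by (simp_all add: xy puiseux_lead_coeff_ramify m)
  have nonneg: "g $$ d \<ge> 0" "h $$ d \<ge> 0"
    using g h by (force simp: d_def min_def not_le order_le_less)+
  have "g $$ d > 0 \<or> h $$ d > 0" using g h by (auto simp: d_def min_def)
  then have pos: "(g + h) $$ d > 0" using nonneg by auto
  have "fls_subdegree (g + h) = d"
    by (rule fls_subdegree_eqI) (use pos in \<open>auto simp: d_def\<close>)
  then show ?thesis
    unfolding xy ramify_add[OF m, symmetric] puiseux_lead_coeff_ramify[OF m] using pos by simp
qed

instantiation puiseux :: linordered_field
begin

definition less_puiseux :: "puiseux \<Rightarrow> puiseux \<Rightarrow> bool" where
  "x < y \<longleftrightarrow> puiseux_lead_coeff (y - x) > 0"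

definition less_eq_puiseux :: "puiseux \<Rightarrow> puiseux \<Rightarrow> bool" where
  "x \<le> y \<longleftrightarrow> x < y \<or> x = (y :: puiseux)"

definition abs_puiseux :: "puiseux \<Rightarrow> puiseux" where
  "\<bar>x\<bar> = (if x < 0 then - x else x :: puiseux)"

definition sgn_puiseux :: "puiseux \<Rightarrow> puiseux" where
  "sgn x = (if x = 0 then 0 else if 0 < x then 1 else - 1 :: puiseux)"

instance
proof
  fix x y z :: puiseux
  have trans: "a < c" if "a < b" "b < c" for a b c :: puiseux
    using puiseux_lead_coeff_add_pos[of "b - a" "c - b"] that by (simp add: less_puiseux_def)
  have irrefl: "\<not> a < a" for a :: puiseux
    by (simp add: less_puiseux_def)
  show "x < y \<longleftrightarrow> x \<le> y \<and> \<not> y \<le> x"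
    using trans[of x y x] irrefl by (auto simp: less_eq_puiseux_def)
  show "x \<le> x" by (simp add: less_eq_puiseux_def)
  show "x \<le> y \<Longrightarrow> y \<le> z \<Longrightarrow> x \<le> z"
    using trans by (auto simp: less_eq_puiseux_def)
  show "x \<le> y \<Longrightarrow> y \<le> x \<Longrightarrow> x = y"
    using trans[of x y x] irrefl by (auto simp: less_eq_puiseux_def)
  show "x \<le> y \<or> y \<le> x"
  proof -
    have "puiseux_lead_coeff (x - y) = - puiseux_lead_coeff (y - x)"
      using puiseux_lead_coeff_uminus[of "y - x"] by simp
    moreover have "x = y" if "puiseux_lead_coeff (y - x) = 0" using that by simp
    ultimately show ?thesis
      unfolding less_eq_puiseux_def less_puiseux_def
      by (metis less_linear neg_0_less_iff_less)
  qed
  show "x \<le> y \<Longrightarrow> z + x \<le> z + y"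
    by (auto simp: less_eq_puiseux_def less_puiseux_def)
  show "x < y \<Longrightarrow> 0 < z \<Longrightarrow> z * x < z * y"
    using puiseux_lead_coeff_mult[of z "y - x"]
    by (simp add: less_puiseux_def right_diff_distrib)
  show "\<bar>x\<bar> = (if x < 0 then - x else x)" by (rule abs_puiseux_def)
  show "sgn x = (if x = 0 then 0 else if 0 < x then 1 else - 1)" by (rule sgn_puiseux_def)
qed

end

lemma puiseux_pos_iff: "(0 :: puiseux) < x \<longleftrightarrow> puiseux_lead_coeff x > 0"
  by (simp add: less_puiseux_def)


unbundle no fps_syntax


section \<open>Signed tropical numbers\<close>

typedef sign = "{1, -1 :: int}"
  morphisms int_of_sign Abs_sign
  by blast

setup_lifting type_definition_sign

instantiation sign :: "{comm_monoid_mult, uminus}"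
begin

lift_definition one_sign :: sign is 1 by simp
lift_definition times_sign :: "sign \<Rightarrow> sign \<Rightarrow> sign" is "(*)" by auto
lift_definition uminus_sign :: "sign \<Rightarrow> sign" is uminus by auto

instance by standard (transfer; simp)+

end

text \<open>Only meaningful for nonzero arguments.\<close>

definition sign_of :: "'a :: linordered_idom \<Rightarrow> sign" where
  "sign_of x = (if x > 0 then 1 else - 1)"

type_synonym tropical = "sign \<times> real"

abbreviation sign :: "tropical \<Rightarrow> sign" where "sign \<equiv> fst"
abbreviation modulus :: "tropical \<Rightarrow> real" where "modulus \<equiv> snd"

definition sign_act :: "sign \<Rightarrow> tropical \<Rightarrow> tropical" where
  "sign_act \<epsilon> a = (\<epsilon> * sign a, modulus a)"

text \<open>Only meaningful for nonzero arguments.\<close>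

definition trop :: "puiseux \<Rightarrow> tropical" where
  "trop x = (sign_of x, of_rat (puiseux_val x))"


section \<open>Real tropical polynomials and hypersurfaces\<close>

text \<open>
  A formal sum of \<open>a\<^sub>l w\<^sup>l\<close> over \<open>l \<in> A\<close> is the partial function with domain \<open>A\<close> and values \<open>a\<^sub>l\<close>;
  finiteness of \<open>A\<close> is stated as \<open>finite (dom f)\<close>.
\<close>

type_synonym 'n trop_poly = "(nat ^ 'n) \<rightharpoonup> tropical"

definition term_modulus :: "('n::finite) trop_poly \<Rightarrow> tropical ^ 'n \<Rightarrow> nat ^ 'n \<Rightarrow> real" where
  "term_modulus f p l = modulus (the (f l)) + (\<Sum>k\<in>UNIV. real (l $ k) * modulus (p $ k))"

definition term_sign :: "('n::finite) trop_poly \<Rightarrow> tropical ^ 'n \<Rightarrow> nat ^ 'n \<Rightarrow> sign" where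
  "term_sign f p l = sign (the (f l)) * (\<Prod>k\<in>UNIV. sign (p $ k) ^ (l $ k))"

definition attains_min :: "('n::finite) trop_poly \<Rightarrow> tropical ^ 'n \<Rightarrow> nat ^ 'n \<Rightarrow> bool" where
  "attains_min f p l \<longleftrightarrow> l \<in> dom f \<and> (\<forall>l'\<in>dom f. term_modulus f p l \<le> term_modulus f p l')"

definition real_trop_hypersurface :: "('n::finite) trop_poly \<Rightarrow> (tropical ^ 'n) set" where
  "real_trop_hypersurface f =
     {p. \<exists>i j. i \<noteq> j \<and> attains_min f p i \<and> attains_min f p j \<and>
               term_sign f p i = 1 \<and> term_sign f p j = - 1}"

definition affine_lattice :: "(nat ^ ('n::finite)) set \<Rightarrow> (int ^ 'n) set" where
  "affine_lattice A =
     {\<Sum>l\<in>B. c l *s (\<chi> k. int (l $ k)) | B c. finite B \<and> B \<subseteq> A \<and> (\<Sum>l\<in>B. c l) = 1}"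

text \<open>The pair \<open>(b\<^sub>0, b)\<close> stands for the affine function \<open>b\<^sub>0 + b\<^sub>1 w\<^sub>1 + \<dots> + b\<^sub>n w\<^sub>n\<close>.\<close>

type_synonym 'n affine_fun = "int \<times> (int ^ 'n)"

definition affine_eval :: "('n::finite) affine_fun \<Rightarrow> nat ^ 'n \<Rightarrow> int" where
  "affine_eval L l = fst L + (\<Sum>k\<in>UNIV. snd L $ k * int (l $ k))"

definition euler_derivative :: "('n::finite) affine_fun \<Rightarrow> 'n trop_poly \<Rightarrow> 'n trop_poly" where
  "euler_derivative L f =
     (\<lambda>l. if affine_eval L l = 0 then None
          else map_option (sign_act (sign_of (affine_eval L l))) (f l))"


section \<open>Tropical singularities\<close>

text \<open>
  The monoid algebra of \<open>\<nat>\<^sup>n\<close> over the Puiseux series, i.e. the polynomial ring in \<open>n\<close> variables;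
  \<open>Poly_Mapping.lookup F l\<close> is the coefficient of \<open>x\<^sup>l\<close>.
\<close>

type_synonym 'n puiseux_poly = "(nat ^ 'n) \<Rightarrow>\<^sub>0 puiseux"

definition poly_eval :: "('n::finite) puiseux_poly \<Rightarrow> puiseux ^ 'n \<Rightarrow> puiseux" where
  "poly_eval F P = (\<Sum>l\<in>Poly_Mapping.keys F. Poly_Mapping.lookup F l * (\<Prod>k\<in>UNIV. (P $ k) ^ (l $ k)))"

text \<open>
  Where \<open>l\<^sub>k = 0\<close> the exponent \<open>l - axis k 1\<close> is truncated to \<open>l\<close>, and the coefficient is \<open>0\<close>.
\<close>

definition partial_deriv :: "('n::finite) \<Rightarrow> 'n puiseux_poly \<Rightarrow> 'n puiseux_poly" where
  "partial_deriv k F =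
     (\<Sum>l\<in>Poly_Mapping.keys F.
        Poly_Mapping.single (l - axis k 1) (of_nat (l $ k) * Poly_Mapping.lookup F l))"

definition is_singular_zero :: "('n::finite) puiseux_poly \<Rightarrow> puiseux ^ 'n \<Rightarrow> bool" where
  "is_singular_zero F P \<longleftrightarrow> poly_eval F P = 0 \<and> (\<forall>k. poly_eval (partial_deriv k F) P = 0)"

definition trop_of_poly :: "('n::finite) puiseux_poly \<Rightarrow> 'n trop_poly" where
  "trop_of_poly F =
     (\<lambda>l. if l \<in> Poly_Mapping.keys F then Some (trop (Poly_Mapping.lookup F l)) else None)"

definition tropical_singularities :: "('n::finite) trop_poly \<Rightarrow> (tropical ^ 'n) set" where
  "tropical_singularities f =
     {p \<in> real_trop_hypersurface f.
        \<exists>F P. is_singular_zero F P \<and> trop_of_poly F = f \<and>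
              (\<forall>k. P $ k \<noteq> 0) \<and> p = (\<chi> k. trop (P $ k))}"

text \<open>
  Valuations of Puiseux series are rational, so every \<open>trop x\<close> has rational modulus.
\<close>

definition rational_points :: "(tropical ^ ('n::finite)) set" where
  "rational_points = {p. \<forall>k. modulus (p $ k) \<in> \<rat>}"

end

theory Submission
  imports Defs
begin

text \<open>
  Substituting a torus point \<open>P\<close> into \<open>F\<close> and its Euler derivatives, \<open>P\<close> is singular iff the
  vector of terms \<open>y\<^sub>l = c\<^sub>l P\<^sup>l\<close> satisfies \<open>\<Sum>\<^sub>l L(l) y\<^sub>l = 0\<close> for all integer affine \<open>L\<close>. The least
  exponent occurring in such a relation must cancel, which gives one inclusion. For the converse the
  \<open>y\<^sub>l\<close> have prescribed signs and valuations, and we set \<open>y = \<Sum>\<^sub>r t\<^sup>r x\<^sup>(\<^sup>r\<^sup>)\<close> over the occurring valuations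
  \<open>r\<close>, where \<open>x\<^sup>(\<^sup>r\<^sup>)\<close> is a rational relation supported on the terms of valuation at most \<open>r\<close> with
  the prescribed signs at those of valuation \<open>r\<close>. By Stiemke's theorem over \<open>\<rat>\<close>, the only
  obstruction to \<open>x\<^sup>(\<^sup>r\<^sup>)\<close> is an \<open>L\<close> for which the hypersurface of \<open>\<partial>f/\<partial>L\<close> misses the point.
\<close>

no_notation fps_nth (infixl "$" 75)

section \<open>Theorems of the alternative over ordered fields\<close>

text \<open>Bartl's induction: a functional violating the claim for \<open>I\<close> is positive on some \<open>z\<close>, and
  projecting along \<open>z\<close> onto the kernel of the new functional reduces to \<open>I\<close>.\<close>

lemma farkas_functionals:
  fixes s :: "'k::linordered_field \<Rightarrow> 'v::ab_group_add \<Rightarrow> 'v" and a :: "'i \<Rightarrow> 'v \<Rightarrow> 'k"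
  assumes "finite I" and "\<And>i. i \<in> I \<Longrightarrow> Vector_Spaces.linear s (*) (a i)"
    and "Vector_Spaces.linear s (*) b"
    and "\<And>x. (\<And>i. i \<in> I \<Longrightarrow> a i x \<ge> 0) \<Longrightarrow> b x \<ge> 0"
  shows "\<exists>c. (\<forall>i\<in>I. c i \<ge> 0) \<and> (\<forall>x. b x = (\<Sum>i\<in>I. c i * a i x))"
  using assms
proof (induction I arbitrary: a b rule: finite_induct)
  case empty
  interpret b: Vector_Spaces.linear s "(*)" b by (rule empty(2))
  have "b x = 0" for x
    using empty(3)[of x] empty(3)[of "- x"] b.neg[of x] by simp
  then show ?case by simp
next
  case (insert j I)
  interpret b: Vector_Spaces.linear s "(*)" b by (rule insert.prems(2))
  have lin: "Vector_Spaces.linear s (*) (a i)" if "i \<in> insert j I" for i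
    using insert.prems(1) that .
  show ?case
  proof (cases "\<forall>x. (\<forall>i\<in>I. a i x \<ge> 0) \<longrightarrow> b x \<ge> 0")
    case True
    then obtain c where c: "\<forall>i\<in>I. c i \<ge> 0" "\<forall>x. b x = (\<Sum>i\<in>I. c i * a i x)"
      using insert.IH[of a b] lin insert.prems(2) by blast
    have "(\<Sum>i\<in>insert j I. (c(j := 0)) i * a i x) = (\<Sum>i\<in>I. c i * a i x)" for x
      using insert.hyps by (auto intro!: sum.cong)
    with c show ?thesis by (intro exI[of _ "c(j := 0)"]) auto
  next
    case False
    then obtain z0 where z0: "\<And>i. i \<in> I \<Longrightarrow> a i z0 \<ge> 0" "b z0 < 0" by force
    interpret aj: Vector_Spaces.linear s "(*)" "a j" by (rule lin) simp
    \<comment> \<open>\<open>z0\<close> meets every condition from \<open>I\<close> and still has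
      \<open>b z0 < 0\<close>, so the condition for \<open>j\<close> must fail at it.\<close>
    have neg: "a j z0 < 0"
      using insert.prems(3)[of z0] z0 by force
    \<comment> \<open>The scaling makes \<open>a j z = - 1\<close>, so that
      \<open>x + s (a j x) z\<close> lies in the kernel of \<open>a j\<close> for every
      \<open>x\<close>.\<close>
    define r where "r = inverse (- a j z0)"
    define z where "z = s r z0"
    have r: "r > 0" "r * a j z0 = - 1" using neg by (simp_all add: r_def)
    have z: "a i z \<ge> 0" if "i \<in> I" for i
    proof -
      interpret ai: Vector_Spaces.linear s "(*)" "a i" by (rule lin) (use that in simp)
      show ?thesis using z0(1)[OF that] r by (simp add: z_def ai.scale)
    qed
    have bz: "b z \<le> 0" using z0(2) r by (simp add: z_def b.scale mult_le_0_iff)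
    have ajz: "a j z = - 1" using r(2) by (simp add: z_def aj.scale)
    \<comment> \<open>These are the pullbacks along the projection \<open>x + s (a j x) z\<close>.
      At a projected point the condition for \<open>j\<close> holds with equality, so only those
      from \<open>I\<close> remain.\<close>
    define a' where "a' i x = a i x + a j x * a i z" for i x
    define b' where "b' x = b x + a j x * b z" for x
    have lin': "Vector_Spaces.linear s (*) (\<lambda>x. g x + a j x * g z)"
      if "Vector_Spaces.linear s (*) g" for g
    proof -
      interpret g: Vector_Spaces.linear s "(*)" g by (rule that)
      show ?thesis
        by unfold_locales (simp_all only: g.add g.scale aj.add aj.scale distrib_left distrib_right ac_simps)
    qed
    have proj: "g (x + s (a j x) z) = g x + a j x * g z"
      if "Vector_Spaces.linear s (*) g" for g x
    proof -
      interpret g: Vector_Spaces.linear s "(*)" g by (rule that)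
      show ?thesis by (simp add: g.add g.scale)
    qed
    have "\<exists>c. (\<forall>i\<in>I. c i \<ge> 0) \<and> (\<forall>x. b' x = (\<Sum>i\<in>I. c i * a' i x))"
    proof (rule insert.IH)
      show "Vector_Spaces.linear s (*) (a' i)" if "i \<in> I" for i
        unfolding a'_def using that by (intro lin' lin) simp
      show "Vector_Spaces.linear s (*) b'"
        unfolding b'_def by (intro lin' insert.prems(2))
      fix x assume x: "\<And>i. i \<in> I \<Longrightarrow> 0 \<le> a' i x"
      have "a i (x + s (a j x) z) \<ge> 0" if "i \<in> insert j I" for i
        using that x[of i] ajz unfolding proj[OF lin[OF that]] a'_def by auto
      then have "b (x + s (a j x) z) \<ge> 0" by (rule insert.prems(3))
      then show "0 \<le> b' x" unfolding b'_def proj[OF insert.prems(2)] .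
    qed
    then obtain c where c: "\<forall>i\<in>I. c i \<ge> 0" "\<forall>x. b' x = (\<Sum>i\<in>I. c i * a' i x)" by blast
    \<comment> \<open>Solving the expansion of \<open>b'\<close> for \<open>b\<close> collects this
      coefficient at \<open>a j\<close>.\<close>
    define d where "d = (\<Sum>i\<in>I. c i * a i z) - b z"
    have "d \<ge> 0" unfolding d_def using c(1) z bz sum_nonneg[of I "\<lambda>i. c i * a i z"] by force
    moreover have "b x = (\<Sum>i\<in>insert j I. (c(j := d)) i * a i x)" for x
    proof -
      have "b' x = (\<Sum>i\<in>I. c i * a i x + a j x * (c i * a i z))"
        unfolding c(2)[rule_format] by (simp only: a'_def distrib_left mult.left_commute)
      also have "\<dots> = (\<Sum>i\<in>I. c i * a i x) + a j x * (\<Sum>i\<in>I. c i * a i z)"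
        by (simp only: sum.distrib sum_distrib_left)
      also have "(\<Sum>i\<in>I. c i * a i x) = (\<Sum>i\<in>I. (c(j := d)) i * a i x)"
        using insert.hyps by (intro sum.cong) auto
      finally have "b x = (\<Sum>i\<in>I. (c(j := d)) i * a i x) + a j x * d"
        unfolding b'_def d_def right_diff_distrib by (simp only: eq_diff_eq add_diff_eq)
      then show ?thesis by (simp only: sum.insert[OF insert.hyps] fun_upd_same ac_simps)
    qed
    ultimately show ?thesis using c(1) by (intro exI[of _ "c(j := d)"]) auto
  qed
qed

text \<open>Where all \<open>a i\<close> are nonnegative they vanish, so Farkas applies to each
  \<open>- a j\<close>. Adding the resulting identities over all \<open>j\<close> gives a relation
  with every coefficient at least 1.\<close>

lemma stiemke_functionals:
  fixes s :: "'k::linordered_field \<Rightarrow> 'v::ab_group_add \<Rightarrow> 'v" and a :: "'i \<Rightarrow> 'v \<Rightarrow> 'k"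
  assumes fin: "finite I" and lin: "\<And>i. i \<in> I \<Longrightarrow> Vector_Spaces.linear s (*) (a i)"
    and alt: "\<And>x i. (\<And>i. i \<in> I \<Longrightarrow> a i x \<ge> 0) \<Longrightarrow> i \<in> I \<Longrightarrow> a i x = 0"
  obtains c where "\<And>i. i \<in> I \<Longrightarrow> c i > 0" "\<And>x. (\<Sum>i\<in>I. c i * a i x) = 0"
proof -
  have "\<exists>c. (\<forall>i\<in>I. c i \<ge> 0) \<and> (\<forall>x. - a j x = (\<Sum>i\<in>I. c i * a i x))" if j: "j \<in> I" for j
  proof (rule farkas_functionals[OF fin lin])
    interpret aj: Vector_Spaces.linear s "(*)" "a j" by (rule lin[OF j])
    show "Vector_Spaces.linear s (*) (\<lambda>x. - a j x)"
      by unfold_locales (simp_all add: aj.add aj.scale)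
    show "0 \<le> - a j x" if "\<And>i. i \<in> I \<Longrightarrow> 0 \<le> a i x" for x
      using alt[OF that j] by simp
  qed
  then obtain c where c: "\<And>j i. j \<in> I \<Longrightarrow> i \<in> I \<Longrightarrow> c j i \<ge> 0"
      "\<And>j x. j \<in> I \<Longrightarrow> - a j x = (\<Sum>i\<in>I. c j i * a i x)"
    by metis
  show ?thesis
  proof (rule that)
    show "1 + (\<Sum>j\<in>I. c j i) > 0" if "i \<in> I" for i
      using c(1) that by (intro add_pos_nonneg sum_nonneg) auto
    fix x
    have "(\<Sum>i\<in>I. (1 + (\<Sum>j\<in>I. c j i)) * a i x)
          = (\<Sum>i\<in>I. a i x) + (\<Sum>i\<in>I. \<Sum>j\<in>I. c j i * a i x)"
      by (simp add: distrib_right sum.distrib sum_distrib_right)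
    also have "(\<Sum>i\<in>I. \<Sum>j\<in>I. c j i * a i x) = (\<Sum>j\<in>I. - a j x)"
      by (subst sum.swap) (simp add: c(2))
    finally show "(\<Sum>i\<in>I. (1 + (\<Sum>j\<in>I. c j i)) * a i x) = 0" by (simp add: sum_negf)
  qed
qed

text \<open>A vanishing condition is encoded by the pair of functionals \<open>a i\<close> and \<open>- a i\<close>.\<close>

lemma stiemke_functionals_mixed:
  fixes s :: "'k::linordered_field \<Rightarrow> 'v::ab_group_add \<Rightarrow> 'v" and a :: "'i \<Rightarrow> 'v \<Rightarrow> 'k"
  assumes fin: "finite B" "finite C" and disj: "B \<inter> C = {}"
    and lin: "\<And>i. i \<in> B \<union> C \<Longrightarrow> Vector_Spaces.linear s (*) (a i)"
    and alt: "\<And>x i. (\<And>i. i \<in> C \<Longrightarrow> a i x = 0) \<Longrightarrow> (\<And>i. i \<in> B \<Longrightarrow> a i x \<ge> 0) \<Longrightarrow>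
                i \<in> B \<Longrightarrow> a i x = 0"
  obtains c where "\<And>i. i \<in> B \<Longrightarrow> c i > 0" "\<And>x. (\<Sum>i\<in>B \<union> C. c i * a i x) = 0"
proof -
  define I where "I = B \<times> {1} \<union> C \<times> {1, - 1 :: 'k}"
  define a' where "a' = (\<lambda>(i, \<sigma>) x. \<sigma> * a i x)"
  have "\<exists>c. (\<forall>j\<in>I. c j > 0) \<and> (\<forall>x. (\<Sum>j\<in>I. c j * a' j x) = 0)"
  proof (rule stiemke_functionals[of I s a'])
    show "finite I" using fin by (simp add: I_def)
    show "Vector_Spaces.linear s (*) (a' j)" if j: "j \<in> I" for j
    proof -
      obtain i \<sigma> where i: "j = (i, \<sigma>)" by fastforce
      then have "i \<in> B \<union> C" using j by (auto simp: I_def)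
      then interpret ai: Vector_Spaces.linear s "(*)" "a i" by (rule lin)
      have "a' j = (\<lambda>x. \<sigma> * a i x)" by (simp add: a'_def i)
      moreover have "Vector_Spaces.linear s (*) (\<lambda>x. \<sigma> * a i x)"
        by unfold_locales (simp_all only: ai.add ai.scale distrib_left mult.left_commute)
      ultimately show ?thesis by simp
    qed
    show "a' j x = 0" if pos: "\<And>i. i \<in> I \<Longrightarrow> 0 \<le> a' i x" and j: "j \<in> I" for x j
    proof -
      have C: "a i x = 0" if "i \<in> C" for i
        using pos[of "(i, 1)"] pos[of "(i, - 1)"] that by (auto simp: I_def a'_def)
      have "a i x \<ge> 0" if "i \<in> B" for i
        using pos[of "(i, 1)"] that by (auto simp: I_def a'_def)
      then have "a i x = 0" if "i \<in> B" for i using alt[of x i] C that by blast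
      then show ?thesis using C j by (auto simp: I_def a'_def)
    qed
  qed blast
  then obtain c where c: "\<forall>j\<in>I. c j > 0" "\<And>x. (\<Sum>j\<in>I. c j * a' j x) = 0" by blast
  \<comment> \<open>On \<open>C\<close> the two coefficients of a pair combine into their
    difference, whose sign is free.\<close>
  define d where "d i = (if i \<in> B then c (i, 1) else c (i, 1) - c (i, - 1))" for i
  show ?thesis
  proof (rule that)
    show "d i > 0" if "i \<in> B" for i using c(1) that by (auto simp: d_def I_def)
    fix x
    have "(\<Sum>j\<in>I. c j * a' j x)
        = (\<Sum>j\<in>B \<times> {1}. c j * a' j x) + (\<Sum>j\<in>C \<times> {1, - 1}. c j * a' j x)"
      unfolding I_def using fin disj by (intro sum.union_disjoint) auto
    also have "(\<Sum>j\<in>B \<times> {1}. c j * a' j x) = (\<Sum>i\<in>B. d i * a i x)"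
      by (simp add: sum.cartesian_product' d_def a'_def)
    also have "(\<Sum>j\<in>C \<times> {1, - 1}. c j * a' j x) = (\<Sum>i\<in>C. d i * a i x)"
      unfolding sum.cartesian_product'
      by (rule sum.cong) (use disj in \<open>auto simp: d_def a'_def algebra_simps\<close>)
    also have "(\<Sum>i\<in>B. d i * a i x) + (\<Sum>i\<in>C. d i * a i x) = (\<Sum>i\<in>B \<union> C. d i * a i x)"
      using fin disj by (simp add: sum.union_disjoint)
    finally show "(\<Sum>i\<in>B \<union> C. d i * a i x) = 0" using c(2) by simp
  qed
qed


section \<open>Leading terms of Puiseux series\<close>

lemma puiseux_nth_0 [simp]: "puiseux_nth 0 q = 0"
  using ramify_0[of 1] puiseux_nth_ramify[of 1 0] by (simp add: ramified_nth_def)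

lemma puiseux_nth_add [simp]: "puiseux_nth (x + y) q = puiseux_nth x q + puiseux_nth y q"
proof (rule puiseux_cases2[of x y])
  fix m g h assume "m > 0" "x = ramify m g" "y = ramify m h"
  then show ?thesis by (simp flip: ramify_add add: puiseux_nth_ramify ramified_nth_def)
qed

lemma puiseux_nth_uminus [simp]: "puiseux_nth (- x) q = - puiseux_nth x q"
  using puiseux_nth_add[of "- x" x q] by simp

lemma puiseux_nth_sum [simp]: "puiseux_nth (\<Sum>i\<in>I. x i) q = (\<Sum>i\<in>I. puiseux_nth (x i) q)"
  by (induction I rule: infinite_finite_induct) simp_all

lemma puiseux_nth_of_int_mult [simp]:
  "puiseux_nth (of_int n * x) q = of_int n * puiseux_nth x q"
proof -
  have "puiseux_nth (of_nat k * x) q = of_nat k * puiseux_nth x q" for k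
    by (induction k) (simp_all add: distrib_right)
  then show ?thesis by (cases n rule: int_cases2) simp_all
qed

lemma puiseux_eqI: "(\<And>q. puiseux_nth x q = puiseux_nth y q) \<Longrightarrow> x = y"
  by (metis ext puiseux_nth_inverse)

lemma puiseux_nth_puiseux_val:
  assumes "x \<noteq> 0"
  shows "puiseux_nth x (puiseux_val x) \<noteq> 0"
  using assms puiseux_lead_coeff_eq_0_iff[of x] by (simp add: puiseux_lead_coeff_def)

text \<open>The rationals are not well-ordered. The least exponent exists because, for a suitable
  \<open>m\<close>, all exponents lie in \<open>1/m\<close> times a set of integers bounded
  below.\<close>

lemma puiseux_val_le:
  assumes "puiseux_nth x q \<noteq> 0"
  shows "puiseux_val x \<le> q"
proof (rule puiseux_cases[of x])
  fix m g assume mg: "m > 0" "x = ramify m g"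
  with assms have "ramified_nth m g q \<noteq> 0" by (simp add: puiseux_nth_ramify)
  then obtain i where i: "q = of_int i / of_nat m" "fls_nth g i \<noteq> 0"
    using mg(1) by (rule ramified_nth_nonzeroE)
  then have "fls_subdegree g \<le> i" "g \<noteq> 0" using fls_subdegree_leI by auto
  then show ?thesis
    using mg(1) by (simp add: mg(2) i(1) puiseux_val_ramify divide_right_mono)
qed

lemma puiseux_val_eqI:
  assumes "puiseux_nth x q \<noteq> 0" and "\<And>r. r < q \<Longrightarrow> puiseux_nth x r = 0"
  shows "puiseux_val x = q"
proof -
  have "x \<noteq> 0" using assms(1) by auto
  then show ?thesis
    using puiseux_val_le[OF assms(1)] puiseux_nth_puiseux_val[of x] assms(2)
    by (metis order_le_less)
qed

lemma puiseux_val_mult: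
  assumes "x \<noteq> 0" "y \<noteq> 0"
  shows "puiseux_val (x * y) = puiseux_val x + puiseux_val y"
proof (rule puiseux_cases2[of x y])
  fix m g h assume m: "m > 0" and xy: "x = ramify m g" "y = ramify m h"
  then have "g \<noteq> 0" "h \<noteq> 0" using assms ramify_0 by auto
  with m show ?thesis
    by (simp flip: ramify_mult add: xy puiseux_val_ramify add_divide_distrib)
qed

lemma puiseux_val_1 [simp]: "puiseux_val 1 = 0"
  using puiseux_val_mult[of 1 1] by simp

lemma puiseux_val_power: "x \<noteq> 0 \<Longrightarrow> puiseux_val (x ^ n) = of_nat n * puiseux_val x"
  by (induction n) (simp_all add: puiseux_val_mult distrib_right)

lemma puiseux_val_prod:
  assumes "finite I" "\<And>i. i \<in> I \<Longrightarrow> x i \<noteq> 0"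
  shows "puiseux_val (\<Prod>i\<in>I. x i) = (\<Sum>i\<in>I. puiseux_val (x i))"
  using assms by (induction I rule: finite_induct) (simp_all add: puiseux_val_mult)

section \<open>Arithmetic of signs and signs of Puiseux series\<close>

lemma sign_neq [simp]: "(1 :: sign) \<noteq> - 1" "- 1 \<noteq> (1 :: sign)"
  by (transfer, simp)+

lemma sign_minus_minus [simp]: "- (- \<sigma>) = (\<sigma> :: sign)"
  by transfer simp

lemma sign_mult_minus [simp]: "- \<sigma> * \<tau> = - (\<sigma> * \<tau> :: sign)" "\<sigma> * - \<tau> = - (\<sigma> * \<tau> :: sign)"
  by (transfer, simp)+

lemma sign_cases: "(\<sigma> :: sign) = 1 \<or> \<sigma> = - 1"
  by transfer auto

lemma sign_mult_self [simp]: "\<sigma> * \<sigma> = (1 :: sign)"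
  by transfer auto

lemma int_of_sign_simps [simp]: "int_of_sign 1 = 1" "int_of_sign (- 1) = - 1"
  by (simp_all add: one_sign.rep_eq uminus_sign.rep_eq)

lemma sign_of_1 [simp]: "sign_of 1 = 1"
  by (simp add: sign_of_def)

lemma sign_of_mult:
  assumes "x \<noteq> 0" "y \<noteq> 0"
  shows "sign_of (x * y) = sign_of x * sign_of y"
  using assms by (auto simp: sign_of_def zero_less_mult_iff)

lemma sign_of_power: "x \<noteq> 0 \<Longrightarrow> sign_of (x ^ n) = sign_of x ^ n"
  by (induction n) (simp_all add: sign_of_mult)

lemma sign_of_prod:
  assumes "finite I" "\<And>i. i \<in> I \<Longrightarrow> x i \<noteq> 0"
  shows "sign_of (\<Prod>i\<in>I. x i) = (\<Prod>i\<in>I. sign_of (x i))"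
  using assms by (induction I rule: finite_induct) (simp_all add: sign_of_mult)

lemma sign_of_of_int [simp]: "sign_of (of_int n :: 'a :: linordered_idom) = sign_of n"
  by (simp add: sign_of_def)

lemma sign_of_int_of_sign [simp]: "sign_of (int_of_sign \<sigma>) = \<sigma>"
  using sign_cases[of \<sigma>] by (auto simp: sign_of_def)

lemma sign_of_puiseux: "x \<noteq> 0 \<Longrightarrow> sign_of x = sign_of (puiseux_nth x (puiseux_val x))"
  by (simp add: sign_of_def puiseux_pos_iff puiseux_lead_coeff_def)

lemma puiseux_val_of_int [simp]: "n \<noteq> 0 \<Longrightarrow> puiseux_val (of_int n) = 0"
proof -
  assume n: "n \<noteq> 0"
  have 1: "puiseux_nth 1 r = (if r = 0 then 1 else 0)" for r
    using ramify_1[of 1] puiseux_nth_ramify[of 1 1]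
    by (auto simp: ramified_nth_def elim!: Ints_cases)
  show ?thesis
    using puiseux_nth_of_int_mult[of n 1] n by (intro puiseux_val_eqI) (simp_all add: 1)
qed

text \<open>The coefficients of the least occurring exponent sum to zero.\<close>

lemma sum_zero_min_val_both_signs:
  fixes u :: "'i \<Rightarrow> puiseux"
  assumes "finite S" "S \<noteq> {}" "\<And>i. i \<in> S \<Longrightarrow> u i \<noteq> 0" "(\<Sum>i\<in>S. u i) = 0"
  obtains i j where "i \<in> S" "\<forall>l\<in>S. puiseux_val (u i) \<le> puiseux_val (u l)" "sign_of (u i) = 1"
    and "j \<in> S" "\<forall>l\<in>S. puiseux_val (u j) \<le> puiseux_val (u l)" "sign_of (u j) = - 1"
proof -
  define m where "m = Min ((\<lambda>i. puiseux_val (u i)) ` S)"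
  have m_le: "m \<le> puiseux_val (u i)" if "i \<in> S" for i
    unfolding m_def using assms(1) that by (intro Min_le) auto
  have "m \<in> (\<lambda>i. puiseux_val (u i)) ` S"
    unfolding m_def using assms(1,2) by (intro Min_in) auto
  then obtain i0 where i0: "i0 \<in> S" "puiseux_val (u i0) = m" by auto
  define a where "a i = puiseux_nth (u i) m" for i
  have nz: "a i0 \<noteq> 0" using puiseux_nth_puiseux_val[OF assms(3)[OF i0(1)]] i0(2) by (simp add: a_def)
  \<comment> \<open>A term with a nonzero coefficient at the overall minimum \<open>m\<close> has
    valuation exactly \<open>m\<close>, so that coefficient is its leading one and decides its
    sign.\<close>
  have a: "puiseux_val (u i) = m \<and> sign_of (u i) = sign_of (a i)" if "i \<in> S" "a i \<noteq> 0" for i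
    using puiseux_val_le[of "u i" m] that m_le[of i] sign_of_puiseux[OF assms(3)]
    by (simp add: a_def)
  have sum0: "(\<Sum>i\<in>S. a i) = 0"
    using arg_cong[OF assms(4), of "\<lambda>x. puiseux_nth x m"] by (simp add: a_def)
  \<comment> \<open>Real numbers that sum to zero and are not all zero take both signs.\<close>
  have "\<exists>i\<in>S. a i > 0"
    using sum_nonneg_eq_0_iff[of S "\<lambda>i. - a i"] sum0 nz i0(1) assms(1)
    by (force simp: sum_negf)
  then obtain i where i: "i \<in> S" "a i > 0" by blast
  have "\<exists>i\<in>S. a i < 0"
    using sum_nonneg_eq_0_iff[of S a] sum0 nz i0(1) assms(1) by force
  then obtain j where j: "j \<in> S" "a j < 0" by blast
  show ?thesis
    by (rule that[of i j]) (use i j a[of i] a[of j] m_le in \<open>auto simp: sign_of_def\<close>)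
qed

section \<open>Monomials with rational exponent\<close>

definition puiseux_monom :: "real \<Rightarrow> rat \<Rightarrow> puiseux" where
  "puiseux_monom c r = Abs_puiseux (\<lambda>q. if q = r then c else 0)"

text \<open>With \<open>r = i / k\<close> this is the coefficient function of the Laurent monomial
  \<open>c X^i\<close> in \<open>t^(1/k)\<close>, which shows that it lies in the carrier of
  \<open>puiseux\<close>.\<close>

lemma puiseux_nth_monom [simp]: "puiseux_nth (puiseux_monom c r) q = (if q = r then c else 0)"
proof -
  obtain i k where r: "r = of_int i / of_nat k" "k > 0"
  proof -
    obtain a b where "quotient_of r = (a, b)" by fastforce
    then have "b > 0" "r = of_int a / of_nat (nat b)"
      using quotient_of_denom_pos[of r a b] quotient_of_div[of r a b] by simp_all
    then show ?thesis by (intro that[of a "nat b"]) auto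
  qed
  have *: "ramified_nth k (fls_const c * fls_X_intpow i) = (\<lambda>q. if q = r then c else 0)"
  proof
    fix q
    show "ramified_nth k (fls_const c * fls_X_intpow i) q = (if q = r then c else 0)"
    proof (cases "of_nat k * q \<in> \<int>")
      case True
      then obtain j where j: "of_nat k * q = of_int j" by (auto elim: Ints_cases)
      have "q = r \<longleftrightarrow> j = i"
        using r(2) j unfolding r(1) by (auto simp: field_simps)
      then show ?thesis by (simp add: ramified_nth_def j)
    next
      case False
      then show ?thesis using r by (auto simp: ramified_nth_def)
    qed
  qed
  then have "puiseux_monom c r = ramify k (fls_const c * fls_X_intpow i)"
    by (simp add: puiseux_monom_def ramify_def)
  then show ?thesis using r(2) * by (simp add: puiseux_nth_ramify)
qed

lemma puiseux_monom_eq_0_iff [simp]: "puiseux_monom c r = 0 \<longleftrightarrow> c = 0"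
  by (metis puiseux_eqI puiseux_nth_0 puiseux_nth_monom)

lemma puiseux_val_monom [simp]: "c \<noteq> 0 \<Longrightarrow> puiseux_val (puiseux_monom c r) = r"
  by (rule puiseux_val_eqI) simp_all

lemma sign_of_puiseux_monom [simp]: "c \<noteq> 0 \<Longrightarrow> sign_of (puiseux_monom c r) = sign_of c"
  by (simp add: sign_of_puiseux)

lemma trop_surj_rational:
  assumes "modulus a \<in> \<rat>"
  obtains x where "x \<noteq> 0" "trop x = a"
proof -
  obtain r where r: "modulus a = of_rat r" using assms by (auto elim: Rats_cases)
  define x where "x = puiseux_monom (of_int (int_of_sign (sign a))) r"
  have "int_of_sign (sign a) \<noteq> 0" using sign_cases[of "sign a"] by auto
  then have "x \<noteq> 0" "trop x = a" using r by (simp_all add: x_def trop_def prod_eq_iff)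
  then show ?thesis by (rule that)
qed


section \<open>Singular points in the torus\<close>

definition monom_eval :: "nat ^ 'n \<Rightarrow> 'a::comm_monoid_mult ^ ('n::finite) \<Rightarrow> 'a" where
  "monom_eval l P = (\<Prod>k\<in>UNIV. (P $ k) ^ (l $ k))"

text \<open>A common index set lets polynomials be added although cancellation may shrink the
  support.\<close>

lemma poly_eval_superset:
  assumes "finite K" "Poly_Mapping.keys F \<subseteq> K"
  shows "poly_eval F P = (\<Sum>l\<in>K. Poly_Mapping.lookup F l * monom_eval l P)"
  unfolding poly_eval_def monom_eval_def
  using assms by (intro sum.mono_neutral_left) (auto simp: in_keys_iff)

lemma poly_eval_add: "poly_eval (F + G) P = poly_eval F P + poly_eval G P"
proof -
  let ?K = "Poly_Mapping.keys F \<union> Poly_Mapping.keys G"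
  have "Poly_Mapping.keys (F + G) \<subseteq> ?K" by (rule Poly_Mapping.keys_add)
  then show ?thesis
    by (simp add: poly_eval_superset[of ?K] lookup_add distrib_right sum.distrib)
qed

lemma poly_eval_sum: "poly_eval (\<Sum>i\<in>I. F i) P = (\<Sum>i\<in>I. poly_eval (F i) P)"
  by (induction I rule: infinite_finite_induct) (simp_all add: poly_eval_add poly_eval_def[of 0])

lemma poly_eval_single: "poly_eval (Poly_Mapping.single l c) P = c * monom_eval l P"
  by (subst poly_eval_superset[of "{l}"]) simp_all

lemma monom_eval_diff_axis:
  assumes "l $ k > 0"
  shows "P $ k * monom_eval (l - axis k 1) P = monom_eval l P"
proof -
  have "(\<Prod>j\<in>UNIV - {k}. (P $ j) ^ ((l - axis k 1) $ j)) = (\<Prod>j\<in>UNIV - {k}. (P $ j) ^ (l $ j))"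
    by (intro prod.cong) (auto simp: axis_def)
  moreover have "P $ k * (P $ k) ^ ((l - axis k 1) $ k) = (P $ k) ^ (l $ k)"
    using assms by (cases "l $ k") (simp_all add: axis_def)
  ultimately show ?thesis
    by (simp add: monom_eval_def prod.remove[of UNIV k] flip: mult.assoc)
qed

text \<open>The operator \<open>x_k d/dx_k\<close> is diagonal on monomials: the factor
  \<open>P $ k\<close> undoes the shift of the exponent, and a truncated exponent carries the
  coefficient 0.\<close>

lemma poly_eval_partial_deriv:
  "P $ k * poly_eval (partial_deriv k F) P
     = (\<Sum>l\<in>Poly_Mapping.keys F. of_nat (l $ k) * (Poly_Mapping.lookup F l * monom_eval l P))"
proof -
  have step: "P $ k * (of_nat (l $ k) * c * monom_eval (l - axis k 1) P)
      = of_nat (l $ k) * (c * monom_eval l P)" for l c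
    using monom_eval_diff_axis[of l k P] by (cases "l $ k = 0") (simp_all add: algebra_simps)
  show ?thesis
    unfolding partial_deriv_def poly_eval_sum poly_eval_single sum_distrib_left step ..
qed

text \<open>The sum for \<open>L\<close> combines \<open>F(P)\<close> and the products of
  \<open>P $ k\<close> with the partial derivatives at \<open>P\<close>, weighted by the
  coefficients of \<open>L\<close>. The constant 1 and the coordinate functions isolate each of
  these, and the nonzero \<open>P $ k\<close> cancels.\<close>

lemma is_singular_zero_iff:
  assumes "\<forall>k. P $ k \<noteq> 0"
  shows "is_singular_zero F P \<longleftrightarrow>
    (\<forall>L. (\<Sum>l\<in>Poly_Mapping.keys F.
            of_int (affine_eval L l) * (Poly_Mapping.lookup F l * monom_eval l P)) = 0)"
    (is "_ \<longleftrightarrow> (\<forall>L. ?E L = 0)")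
proof -
  let ?K = "Poly_Mapping.keys F" and ?u = "\<lambda>l. Poly_Mapping.lookup F l * monom_eval l P"
  have E: "?E L = of_int (fst L) * poly_eval F P
      + (\<Sum>k\<in>UNIV. of_int (snd L $ k) * (P $ k * poly_eval (partial_deriv k F) P))" for L
  proof -
    have "?E L = (\<Sum>l\<in>?K. of_int (fst L) * ?u l)
        + (\<Sum>l\<in>?K. \<Sum>k\<in>UNIV. of_int (snd L $ k) * (of_nat (l $ k) * ?u l))"
      by (simp add: affine_eval_def distrib_right sum.distrib sum_distrib_right mult.assoc)
    also have "(\<Sum>l\<in>?K. of_int (fst L) * ?u l) = of_int (fst L) * poly_eval F P"
      by (simp add: poly_eval_superset[of ?K] sum_distrib_left)
    also have "(\<Sum>l\<in>?K. \<Sum>k\<in>UNIV. of_int (snd L $ k) * (of_nat (l $ k) * ?u l))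
        = (\<Sum>k\<in>UNIV. of_int (snd L $ k) * (P $ k * poly_eval (partial_deriv k F) P))"
      by (subst sum.swap) (simp add: poly_eval_partial_deriv sum_distrib_left)
    finally show ?thesis .
  qed
  show ?thesis
  proof
    assume "is_singular_zero F P"
    then show "\<forall>L. ?E L = 0" unfolding E by (simp add: is_singular_zero_def)
  next
    assume *: "\<forall>L. ?E L = 0"
    have "poly_eval F P = 0" using *[rule_format, of "(1, 0)"] unfolding E by simp
    moreover have "poly_eval (partial_deriv k F) P = 0" for k
    proof -
      have "(\<Sum>j\<in>UNIV. of_int (axis k 1 $ j) * (P $ j * poly_eval (partial_deriv j F) P))
          = (\<Sum>j\<in>UNIV. if j = k then P $ j * poly_eval (partial_deriv j F) P else 0)"
        by (intro sum.cong) (auto simp: axis_def)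
      then show ?thesis
        using *[rule_format, of "(0, axis k 1)"] assms unfolding E by simp
    qed
    ultimately show "is_singular_zero F P" by (simp add: is_singular_zero_def)
  qed
qed


section \<open>Euler derivatives\<close>

text \<open>An affine function vanishing on \<open>A\<close> vanishes on all combinations with
  coefficient sum 1, hence on the whole integer lattice. Its values at 0 and at the unit vectors
  then give all its coefficients.\<close>

lemma affine_eval_nonzero_exists:
  assumes "affine_lattice A = UNIV" "L \<noteq> 0"
  shows "\<exists>l\<in>A. affine_eval L l \<noteq> 0"
proof (rule ccontr)
  assume "\<not> ?thesis"
  then have A: "affine_eval L l = 0" if "l \<in> A" for l using that by blast
  have zero: "fst L + (\<Sum>k\<in>UNIV. snd L $ k * z $ k) = 0" for z
  proof -
    have "z \<in> affine_lattice A" using assms(1) by simp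
    then obtain B c where B: "finite B" "B \<subseteq> A" "(\<Sum>l\<in>B. c l) = 1"
        and z: "z = (\<Sum>l\<in>B. c l *s (\<chi> k. int (l $ k)))"
      unfolding affine_lattice_def by blast
    have "(\<Sum>k\<in>UNIV. snd L $ k * z $ k) = (\<Sum>k\<in>UNIV. \<Sum>l\<in>B. c l * (snd L $ k * int (l $ k)))"
      by (simp add: z sum_distrib_left mult_ac)
    also have "\<dots> = (\<Sum>l\<in>B. c l * (\<Sum>k\<in>UNIV. snd L $ k * int (l $ k)))"
      by (subst sum.swap) (simp add: sum_distrib_left)
    finally have "fst L + (\<Sum>k\<in>UNIV. snd L $ k * z $ k)
        = (\<Sum>l\<in>B. c l) * fst L + (\<Sum>l\<in>B. c l * (\<Sum>k\<in>UNIV. snd L $ k * int (l $ k)))"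
      using B(3) by simp
    also have "\<dots> = (\<Sum>l\<in>B. c l * affine_eval L l)"
      by (simp add: affine_eval_def distrib_left sum.distrib sum_distrib_right)
    also have "\<dots> = 0" using A B(2) by (intro sum.neutral) auto
    finally show ?thesis .
  qed
  have fst0: "fst L = 0" using zero[of 0] by simp
  have "snd L $ k = 0" for k
  proof -
    have "(\<Sum>j\<in>UNIV. snd L $ j * axis k 1 $ j) = (\<Sum>j\<in>UNIV. if j = k then snd L $ j else 0)"
      by (intro sum.cong) (auto simp: axis_def)
    then show ?thesis using zero[of "axis k 1"] fst0 by simp
  qed
  then have "L = 0" using fst0 by (simp add: prod_eq_iff vec_eq_iff)
  then show False using assms(2) by simp
qed

lemma dom_euler_derivative: "dom (euler_derivative L f) = {l \<in> dom f. affine_eval L l \<noteq> 0}"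
  by (auto simp: euler_derivative_def split: if_splits)

lemma term_modulus_euler_derivative:
  "l \<in> dom (euler_derivative L f) \<Longrightarrow> term_modulus (euler_derivative L f) p l = term_modulus f p l"
  by (auto simp: term_modulus_def euler_derivative_def sign_act_def split: if_splits)

lemma term_sign_euler_derivative:
  "l \<in> dom (euler_derivative L f) \<Longrightarrow>
     term_sign (euler_derivative L f) p l = sign_of (affine_eval L l) * term_sign f p l"
  by (auto simp: term_sign_def euler_derivative_def sign_act_def mult.assoc split: if_splits)

text \<open>This places \<open>f\<close> among its own Euler derivatives, so the intersection lies
  in the hypersurface of \<open>f\<close>.\<close>

lemma euler_derivative_1: "euler_derivative (1, 0) f = f"
proof
  have "sign_act 1 = id" by (auto simp: sign_act_def)
  then show "euler_derivative (1, 0) f l = f l" for l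
    by (simp add: euler_derivative_def affine_eval_def option.map_id)
qed

text \<open>Exponents whose terms have opposite signs are distinct, so the two witnesses can be
  sought separately.\<close>

lemma real_trop_hypersurface_iff:
  "p \<in> real_trop_hypersurface f \<longleftrightarrow>
     (\<exists>i. attains_min f p i \<and> term_sign f p i = 1) \<and>
     (\<exists>j. attains_min f p j \<and> term_sign f p j = - 1)"
  unfolding real_trop_hypersurface_def using sign_neq(1) by (simp, metis)

lemma trop_mult_monom_eval:
  assumes "c \<noteq> 0" "\<forall>k. P $ k \<noteq> 0"
  shows "sign_of (c * monom_eval l P) = sign_of c * (\<Prod>k\<in>UNIV. sign_of (P $ k) ^ (l $ k))"
    and "puiseux_val (c * monom_eval l P)
           = puiseux_val c + (\<Sum>k\<in>UNIV. of_nat (l $ k) * puiseux_val (P $ k))"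
  using assms
  by (simp_all add: monom_eval_def sign_of_mult sign_of_prod sign_of_power
      puiseux_val_mult puiseux_val_prod puiseux_val_power)

lemma term_trop:
  assumes "the (f l) = trop c" "c \<noteq> 0" "\<forall>k. P $ k \<noteq> 0" "p = (\<chi> k. trop (P $ k))"
  shows "term_sign f p l = sign_of (c * monom_eval l P)"
    and "term_modulus f p l = of_rat (puiseux_val (c * monom_eval l P))"
  using assms(1,4)
  by (simp_all add: trop_mult_monom_eval[OF assms(2,3)] term_sign_def term_modulus_def trop_def
      of_rat_add of_rat_sum of_rat_mult)

text \<open>The nonzero summands \<open>L(l) u_l\<close> add up to zero, so their least valuation
  occurs with both signs. A nonzero integer factor has valuation 0: it keeps the weight and
  multiplies the sign by that of \<open>L(l)\<close>, just as the Euler derivative does.\<close>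

lemma singular_zero_imp_mem_euler_derivative:
  assumes "affine_lattice (dom f) = UNIV" "L \<noteq> 0"
    and sing: "is_singular_zero F P" and f: "trop_of_poly F = f"
    and P: "\<forall>k. P $ k \<noteq> 0" and p: "p = (\<chi> k. trop (P $ k))"
  shows "p \<in> real_trop_hypersurface (euler_derivative L f)"
proof -
  let ?g = "euler_derivative L f"
  let ?K = "Poly_Mapping.keys F"
  define u where "u l = Poly_Mapping.lookup F l * monom_eval l P" for l
  define S where "S = dom ?g"
  have dom: "dom f = ?K" by (auto simp: trop_of_poly_def f[symmetric] split: if_splits)
  then have S: "S = {l \<in> ?K. affine_eval L l \<noteq> 0}" by (simp add: S_def dom_euler_derivative)
  have u: "u l \<noteq> 0" "term_sign f p l = sign_of (u l)" "term_modulus f p l = of_rat (puiseux_val (u l))"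
    if "l \<in> ?K" for l
  proof -
    have *: "the (f l) = trop (Poly_Mapping.lookup F l)" "Poly_Mapping.lookup F l \<noteq> 0"
      using that by (auto simp: f[symmetric] trop_of_poly_def in_keys_iff)
    show "u l \<noteq> 0" using *(2) P by (simp add: u_def monom_eval_def)
    show "term_sign f p l = sign_of (u l)" "term_modulus f p l = of_rat (puiseux_val (u l))"
      unfolding u_def using * P p by (rule term_trop)+
  qed
  have "(\<Sum>l\<in>S. of_int (affine_eval L l) * u l) = (\<Sum>l\<in>?K. of_int (affine_eval L l) * u l)"
    by (intro sum.mono_neutral_left) (auto simp: S)
  also have "\<dots> = 0" using sing unfolding is_singular_zero_iff[OF P] u_def by blast
  finally have sum0: "(\<Sum>l\<in>S. of_int (affine_eval L l) * u l) = 0" .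
  \<comment> \<open>The lattice condition enters here: a nonzero \<open>L\<close> keeps at least one
    monomial.\<close>
  have "finite S" "S \<noteq> {}"
    using affine_eval_nonzero_exists[OF assms(1,2)] dom by (auto simp: S)
  moreover have "of_int (affine_eval L l) * u l \<noteq> 0" if "l \<in> S" for l using that u by (simp add: S)
  ultimately obtain i j where
    i: "i \<in> S" "\<forall>l\<in>S. puiseux_val (of_int (affine_eval L i) * u i) \<le> puiseux_val (of_int (affine_eval L l) * u l)"
      "sign_of (of_int (affine_eval L i) * u i) = 1" and
    j: "j \<in> S" "\<forall>l\<in>S. puiseux_val (of_int (affine_eval L j) * u j) \<le> puiseux_val (of_int (affine_eval L l) * u l)"
      "sign_of (of_int (affine_eval L j) * u j) = - 1"
    using sum0 by (rule sum_zero_min_val_both_signs)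
  have val: "puiseux_val (of_int (affine_eval L l) * u l) = puiseux_val (u l)"
    and sgn: "term_sign ?g p l = sign_of (of_int (affine_eval L l) * u l)"
    and md: "term_modulus ?g p l = of_rat (puiseux_val (u l))" if "l \<in> S" for l
    using that u[of l] term_sign_euler_derivative[of l L f p] term_modulus_euler_derivative[of l L f p]
    by (simp_all add: S_def[symmetric]) (simp_all add: S puiseux_val_mult sign_of_mult)
  have "attains_min ?g p i" "attains_min ?g p j"
    unfolding attains_min_def S_def[symmetric]
    using i j val md by (simp_all add: of_rat_less_eq)
  then show ?thesis
    unfolding real_trop_hypersurface_iff using sgn i j by auto
qed


section \<open>Lifting tropical singularities\<close>

lemma common_denominator:
  fixes Q :: "rat set"
  assumes "finite Q"
  obtains N :: int where "N > 0" "\<And>q. q \<in> Q \<Longrightarrow> of_int N * q \<in> \<int>"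
proof -
  have "\<exists>N::int. N > 0 \<and> (\<forall>q\<in>Q. of_int N * q \<in> \<int>)"
    using assms
  proof (induction Q rule: finite_induct)
    case empty
    show ?case by (intro exI[of _ 1]) simp
  next
    case (insert r Q)
    then obtain N :: int where N: "N > 0" "\<forall>q\<in>Q. of_int N * q \<in> \<int>" by blast
    obtain a b where r: "quotient_of r = (a, b)" by fastforce
    then have b: "b > 0" "r = of_int a / of_int b"
      by (rule quotient_of_denom_pos, rule quotient_of_div)
    have "of_int (N * b) * q \<in> \<int>" if q: "q \<in> insert r Q" for q
    proof (cases "q = r")
      case True
      then have "of_int (N * b) * q = of_int (N * a)" using b by simp
      then show ?thesis by (simp only: Ints_of_int)
    next
      case False
      then have "of_int N * q \<in> \<int>" using N(2) q by simp
      then have "of_int b * (of_int N * q) \<in> \<int>" using Ints_of_int by (rule Ints_mult[rotated])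
      then show ?thesis by (simp add: mult_ac)
    qed
    then show ?case using N(1) b(1) by (intro exI[of _ "N * b"]) auto
  qed
  then show ?thesis using that by blast
qed

text \<open>Stiemke's theorem is applied over the field of rationals, which calls for affine
  functions with rational coefficients.\<close>

definition rat_affine_eval :: "rat \<times> (rat ^ ('n::finite)) \<Rightarrow> nat ^ 'n \<Rightarrow> rat" where
  "rat_affine_eval x l = fst x + (\<Sum>k\<in>UNIV. snd x $ k * of_nat (l $ k))"

lemma rat_affine_eval_of_int:
  "rat_affine_eval (of_int (fst L), \<chi> k. of_int (snd L $ k)) l = of_int (affine_eval L l)"
  by (simp add: rat_affine_eval_def affine_eval_def)

text \<open>A positive common denominator preserves zeros and signs, which carries separating
  functions back to integer coefficients.\<close>

lemma rat_affine_eval_clear_denominators: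
  obtains N L where "N > 0" "\<And>l. of_int (affine_eval L l) = of_int N * rat_affine_eval x l"
proof -
  obtain N :: int where N: "N > 0" "\<And>q. q \<in> insert (fst x) (range (\<lambda>k. snd x $ k)) \<Longrightarrow> of_int N * q \<in> \<int>"
    by (rule common_denominator[of "insert (fst x) (range (\<lambda>k. snd x $ k))"]) auto
  define L where "L = (\<lfloor>of_int N * fst x\<rfloor>, \<chi> k. \<lfloor>of_int N * (snd x $ k)\<rfloor>)"
  have "of_int (fst L) = of_int N * fst x" "of_int (snd L $ k) = of_int N * snd x $ k" for k
    using N(2) by (auto simp: L_def elim!: Ints_cases)
  then have "of_int (affine_eval L l) = of_int N * rat_affine_eval x l" for l
    by (simp add: affine_eval_def rat_affine_eval_def distrib_left sum_distrib_left mult.assoc)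
  then show ?thesis using N(1) that by blast
qed

text \<open>A separating \<open>L\<close> for the weight level \<open>r\<close> would have its minimal weight \<open>r\<close> attained with
  one sign only.\<close>

lemma level_relation:
  fixes A :: "(nat ^ ('n::finite)) set" and w :: "nat ^ 'n \<Rightarrow> rat" and \<epsilon> :: "nat ^ 'n \<Rightarrow> sign"
  assumes fin: "finite A"
    and neg: "\<And>L. L \<noteq> 0 \<Longrightarrow> \<exists>j\<in>A. affine_eval L j \<noteq> 0 \<and>
        (\<forall>l\<in>A. affine_eval L l \<noteq> 0 \<longrightarrow> w j \<le> w l) \<and> sign_of (affine_eval L j) * \<epsilon> j = - 1"
  obtains x :: "nat ^ 'n \<Rightarrow> rat"
  where "\<And>l. l \<in> A \<Longrightarrow> w l = r \<Longrightarrow> x l \<noteq> 0 \<and> sign_of (x l) = \<epsilon> l"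
    and "\<And>l. w l > r \<Longrightarrow> x l = 0"
    and "\<And>L. (\<Sum>l\<in>A. of_int (affine_eval L l) * x l) = 0"
proof -
  \<comment> \<open>Terms on level \<open>r\<close> need a prescribed sign, those of smaller weight
    may take any coefficient.\<close>
  define B C where "B = {l \<in> A. w l = r}" and "C = {l \<in> A. w l < r}"
  define s where "s c v = (c * fst v, c *s snd v)" for c :: rat and v :: "rat \<times> (rat ^ 'n)"
  define \<sigma> :: "nat ^ 'n \<Rightarrow> rat" where "\<sigma> l = of_int (int_of_sign (\<epsilon> l))" for l
  have \<sigma>: "\<sigma> l \<noteq> 0" "\<epsilon> l = 1 \<Longrightarrow> \<sigma> l = 1" "\<epsilon> l = - 1 \<Longrightarrow> \<sigma> l = - 1" for l
    using sign_cases[of "\<epsilon> l"] by (auto simp: \<sigma>_def)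
  \<comment> \<open>The factor \<open>\<sigma> l\<close> turns the sign prescription into positivity
    of the Stiemke coefficient.\<close>
  define a where "a l v = \<sigma> l * rat_affine_eval v l" for l v
  have vs: "vector_space s"
    by unfold_locales (simp_all add: s_def prod_eq_iff vec_eq_iff algebra_simps)
  have vs': "vector_space ((*) :: rat \<Rightarrow> rat \<Rightarrow> rat)"
    by unfold_locales (simp_all add: algebra_simps)
  have lin: "Vector_Spaces.linear s (*) (a l)" for l
    unfolding Vector_Spaces.linear_iff
    using vs vs' by (simp add: a_def rat_affine_eval_def s_def algebra_simps sum.distrib sum_distrib_left)
  have alt: "a i v = 0" if C: "\<And>l. l \<in> C \<Longrightarrow> a l v = 0" and B: "\<And>l. l \<in> B \<Longrightarrow> a l v \<ge> 0"
    and i: "i \<in> B" for v i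
  proof (rule ccontr)
    assume nz: "a i v \<noteq> 0"
    obtain N L where N: "N > 0" and L: "\<And>l. of_int (affine_eval L l) = of_int N * rat_affine_eval v l"
      by (rule rat_affine_eval_clear_denominators[of v]) blast
    have L0: "affine_eval L l = 0 \<longleftrightarrow> a l v = 0" for l
      using L[of l] N \<sigma>(1)[of l] by (auto simp: a_def)
    have "L \<noteq> 0" using nz L0[of i] by (auto simp: affine_eval_def)
    then obtain j where j: "j \<in> A" "affine_eval L j \<noteq> 0" "sign_of (affine_eval L j) * \<epsilon> j = - 1"
        and min: "\<forall>l\<in>A. affine_eval L l \<noteq> 0 \<longrightarrow> w j \<le> w l"
      using neg by blast
    \<comment> \<open>\<open>L\<close> is nonzero at \<open>i\<close>, which has weight
      \<open>r\<close>, and vanishes on \<open>C\<close>; hence its minimal term \<open>j\<close>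
      lies on level \<open>r\<close>.\<close>
    have "w j \<le> r" using min i nz L0[of i] by (auto simp: B_def)
    then have "j \<in> B" using C[of j] L0[of j] j(1,2) by (force simp: B_def C_def)
    then have "of_int N * a j v \<ge> 0" using B[of j] N by simp
    then have *: "\<sigma> j * of_int (affine_eval L j) \<ge> 0" unfolding L a_def by (simp add: mult_ac)
    \<comment> \<open>The choice of \<open>j\<close> gives \<open>affine_eval L j\<close> the sign
      opposite to \<open>\<epsilon> j\<close>, which makes this nonzero product negative.\<close>
    then show False
      using sign_cases[of "\<epsilon> j"] \<sigma>(2,3)[of j] j(2,3) by (auto simp: sign_of_def split: if_splits)
  qed
  have "finite B" "finite C" "B \<inter> C = {}" using fin by (auto simp: B_def C_def)
  then obtain c where c: "\<And>l. l \<in> B \<Longrightarrow> c l > 0" "\<And>v. (\<Sum>l\<in>B \<union> C. c l * a l v) = 0"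
    using lin alt by (rule stiemke_functionals_mixed[where a = a]) blast+
  \<comment> \<open>The cutoff forces zeros above level \<open>r\<close> also outside
    \<open>A\<close>, where \<open>c\<close> is arbitrary.\<close>
  define x where "x l = (if w l \<le> r then c l * \<sigma> l else 0)" for l
  show ?thesis
  proof (rule that)
    show "x l \<noteq> 0 \<and> sign_of (x l) = \<epsilon> l" if "l \<in> A" "w l = r" for l
      using c(1)[of l] \<sigma>[of l] sign_cases[of "\<epsilon> l"] that by (auto simp: x_def B_def sign_of_def)
    show "x l = 0" if "w l > r" for l using that by (simp add: x_def)
    fix L :: "'n affine_fun"
    have "(\<Sum>l\<in>A. of_int (affine_eval L l) * x l) = (\<Sum>l\<in>B \<union> C. of_int (affine_eval L l) * x l)"
      using fin by (intro sum.mono_neutral_right) (auto simp: B_def C_def x_def)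
    also have "\<dots> = (\<Sum>l\<in>B \<union> C. c l * a l (of_int (fst L), \<chi> k. of_int (snd L $ k)))"
      by (intro sum.cong) (auto simp: a_def x_def rat_affine_eval_of_int B_def C_def)
    finally show "(\<Sum>l\<in>A. of_int (affine_eval L l) * x l) = 0" using c(2) by simp
  qed
qed

text \<open>The terms \<open>y l\<close> are assembled first from the level relations; dividing out
  the monomials of a lift \<open>P\<close> of \<open>p\<close> then yields the coefficients of
  \<open>F\<close>.\<close>

lemma mem_euler_derivatives_lift:
  fixes f :: "('n::finite) trop_poly"
  assumes fin: "finite (dom f)" and rat: "\<forall>a\<in>ran f. modulus a \<in> \<rat>" and p: "p \<in> rational_points"
    and mem: "\<And>L. L \<noteq> 0 \<Longrightarrow> p \<in> real_trop_hypersurface (euler_derivative L f)"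
  obtains F P where "is_singular_zero F P" "trop_of_poly F = f" "\<forall>k. P $ k \<noteq> 0"
    "p = (\<chi> k. trop (P $ k))"
proof -
  let ?A = "dom f"
  have "\<forall>k. \<exists>x. x \<noteq> 0 \<and> trop x = p $ k"
    using p unfolding rational_points_def by (metis (mono_tags, lifting) mem_Collect_eq trop_surj_rational)
  then obtain P0 where P0: "\<forall>k. P0 k \<noteq> 0 \<and> trop (P0 k) = p $ k" by metis
  define P where "P = (\<chi> k. P0 k)"
  have P: "\<forall>k. P $ k \<noteq> 0" and pP: "p = (\<chi> k. trop (P $ k))"
    using P0 by (simp_all add: P_def vec_eq_iff)
  have "term_modulus f p l \<in> \<rat>" if "l \<in> ?A" for l
  proof -
    have "modulus (the (f l)) \<in> \<rat>" using rat that by (force intro: ranI)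
    moreover have "modulus (p $ k) \<in> \<rat>" for k using p by (simp add: rational_points_def)
    ultimately show ?thesis unfolding term_modulus_def by (intro Rats_add Rats_sum Rats_mult) simp_all
  qed
  then have "\<forall>l\<in>?A. \<exists>q. term_modulus f p l = of_rat q" by (auto elim: Rats_cases)
  then obtain w where w: "\<And>l. l \<in> ?A \<Longrightarrow> term_modulus f p l = of_rat (w l)" by metis
  \<comment> \<open>Recording a minimal term of negative sign for each \<open>L\<close> suffices:
    for the negative of \<open>L\<close> it is one of positive sign for \<open>L\<close>.\<close>
  have neg: "\<exists>j\<in>?A. affine_eval L j \<noteq> 0 \<and>
        (\<forall>l\<in>?A. affine_eval L l \<noteq> 0 \<longrightarrow> w j \<le> w l) \<and> sign_of (affine_eval L j) * term_sign f p j = - 1"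
    if L: "L \<noteq> 0" for L
  proof -
    let ?g = "euler_derivative L f"
    obtain j where j: "attains_min ?g p j" "term_sign ?g p j = - 1"
      using mem[OF L] unfolding real_trop_hypersurface_iff by blast
    then have jd: "j \<in> dom ?g" by (simp add: attains_min_def)
    have "w j \<le> w l" if "l \<in> ?A" "affine_eval L l \<noteq> 0" for l
    proof -
      have l: "l \<in> dom ?g" using that by (simp add: dom_euler_derivative)
      then have "term_modulus ?g p j \<le> term_modulus ?g p l" using j(1) by (simp add: attains_min_def)
      then show ?thesis
        using w[of j] w[of l] l jd
        by (simp add: term_modulus_euler_derivative dom_euler_derivative of_rat_less_eq)
    qed
    moreover have "sign_of (affine_eval L j) * term_sign f p j = - 1"
      using j(2) jd by (simp add: term_sign_euler_derivative)
    ultimately show ?thesis using jd unfolding dom_euler_derivative by blast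
  qed
  have "\<forall>r. \<exists>x :: nat ^ 'n \<Rightarrow> rat. (\<forall>l\<in>?A. w l = r \<longrightarrow> x l \<noteq> 0 \<and> sign_of (x l) = term_sign f p l) \<and>
      (\<forall>l. w l > r \<longrightarrow> x l = 0) \<and> (\<forall>L. (\<Sum>l\<in>?A. of_int (affine_eval L l) * x l) = 0)"
  proof
    fix r
    show "\<exists>x :: nat ^ 'n \<Rightarrow> rat. (\<forall>l\<in>?A. w l = r \<longrightarrow> x l \<noteq> 0 \<and> sign_of (x l) = term_sign f p l) \<and>
      (\<forall>l. w l > r \<longrightarrow> x l = 0) \<and> (\<forall>L. (\<Sum>l\<in>?A. of_int (affine_eval L l) * x l) = 0)"
      by (rule level_relation[of ?A w "term_sign f p" r]) (use fin neg in blast)+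
  qed
  then obtain x :: "rat \<Rightarrow> nat ^ 'n \<Rightarrow> rat" where
    x1: "\<And>r l. l \<in> ?A \<Longrightarrow> w l = r \<Longrightarrow> x r l \<noteq> 0 \<and> sign_of (x r l) = term_sign f p l" and
    x2: "\<And>r l. w l > r \<Longrightarrow> x r l = 0" and
    x3: "\<And>r L. (\<Sum>l\<in>?A. of_int (affine_eval L l) * x r l) = 0"
    by metis
  \<comment> \<open>The coefficient of \<open>t^r\<close> in \<open>y l\<close> is
    \<open>x r l\<close>. It vanishes for \<open>r < w l\<close> and has the required sign at
    \<open>r = w l\<close>.\<close>
  define y where "y l = (\<Sum>r\<in>w ` ?A. puiseux_monom (of_rat (x r l)) r)" for l
  have nth_y: "puiseux_nth (y l) q = (if q \<in> w ` ?A then of_rat (x q l) else 0)" for l q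
    using fin by (simp add: y_def)
  have y: "y l \<noteq> 0" "puiseux_val (y l) = w l" "sign_of (y l) = term_sign f p l" if "l \<in> ?A" for l
  proof -
    have nz: "puiseux_nth (y l) (w l) \<noteq> 0" using x1[OF that] that by (simp add: nth_y)
    then show "y l \<noteq> 0" by auto
    show val: "puiseux_val (y l) = w l"
      using nz by (rule puiseux_val_eqI) (simp add: nth_y x2)
    have "sign_of (y l) = sign_of (of_rat (x (w l) l) :: real)"
      using sign_of_puiseux[OF \<open>y l \<noteq> 0\<close>] that unfolding val by (simp add: nth_y)
    also have "\<dots> = term_sign f p l" using x1[OF that] by (simp add: sign_of_def)
    finally show "sign_of (y l) = term_sign f p l" .
  qed
  \<comment> \<open>Every coefficient of this sum is either a level relation or zero.\<close>
  have sum_y: "(\<Sum>l\<in>?A. of_int (affine_eval L l) * y l) = 0" for L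
  proof (rule puiseux_eqI)
    fix q
    have "(\<Sum>l\<in>?A. of_int (affine_eval L l) * of_rat (x q l)) = (of_rat 0 :: real)"
      unfolding x3[of L q, symmetric] by (simp add: of_rat_sum of_rat_mult)
    then show "puiseux_nth (\<Sum>l\<in>?A. of_int (affine_eval L l) * y l) q = puiseux_nth 0 q"
      by (cases "q \<in> w ` ?A") (simp_all add: nth_y)
  qed
  define c where "c l = (if l \<in> ?A then y l / monom_eval l P else 0)" for l
  define F where "F = Abs_poly_mapping c"
  have mon: "monom_eval l P \<noteq> 0" for l using P by (simp add: monom_eval_def)
  have c: "c l \<noteq> 0 \<longleftrightarrow> l \<in> ?A" for l using y(1) mon by (simp add: c_def)
  have lookup: "Poly_Mapping.lookup F = c"
    unfolding F_def using fin by (intro lookup_Abs_poly_mapping) (simp add: c)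
  have keys: "Poly_Mapping.keys F = ?A" by (auto simp: in_keys_iff lookup c)
  have cy: "c l * monom_eval l P = y l" if "l \<in> ?A" for l using that mon by (simp add: c_def)
  have trop: "trop (c l) = the (f l)" if l: "l \<in> ?A" for l
  proof -
    let ?\<pi> = "\<Prod>k\<in>UNIV. sign (p $ k) ^ (l $ k)"
    have cnz: "c l \<noteq> 0" using l c by simp
    note tr = trop_mult_monom_eval[OF cnz P, of l, unfolded cy[OF l]]
    have "sign_of (c l) * ?\<pi> = sign (the (f l)) * ?\<pi>"
      using tr(1) y(3)[OF l] by (simp add: term_sign_def pP trop_def)
    \<comment> \<open>Signs are their own inverses, so a second factor cancels the first.\<close>
    then have "sign_of (c l) * ?\<pi> * ?\<pi> = sign (the (f l)) * ?\<pi> * ?\<pi>" by simp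
    then have "sign_of (c l) = sign (the (f l))" by (simp add: mult.assoc)
    moreover have "of_rat (puiseux_val (c l)) = modulus (the (f l))"
      using arg_cong[OF tr(2), of "of_rat :: rat \<Rightarrow> real"] y(2)[OF l] w[OF l]
      by (simp add: term_modulus_def pP trop_def of_rat_add of_rat_sum of_rat_mult)
    ultimately show ?thesis by (simp add: trop_def prod_eq_iff)
  qed
  show ?thesis
  proof (rule that[OF _ _ P pP])
    show "is_singular_zero F P"
      unfolding is_singular_zero_iff[OF P] keys lookup using sum_y cy by simp
    show "trop_of_poly F = f"
    proof
      show "trop_of_poly F l = f l" for l
        using trop[of l] by (cases "f l") (simp_all add: trop_of_poly_def keys lookup domIff)
    qed
  qed
qed

text \<open>Moduli of values of \<open>trop\<close> are rational, while the intersection may contain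
  points with irrational moduli. Hence the rational coefficients and the restriction to
  \<open>rational_points\<close>.\<close>

theorem theorem4p4:
  fixes f :: "('n::finite) trop_poly"
  assumes "finite (dom f)"
    and "affine_lattice (dom f) = UNIV"
    and "\<forall>a\<in>ran f. modulus a \<in> \<rat>"
  shows "tropical_singularities f =
         (\<Inter>L\<in>{L. L \<noteq> 0}. real_trop_hypersurface (euler_derivative L f)) \<inter> rational_points"
proof (intro equalityI subsetI)
  fix p assume "p \<in> tropical_singularities f"
  then obtain F P where FP: "is_singular_zero F P" "trop_of_poly F = f" "\<forall>k. P $ k \<noteq> 0"
      "p = (\<chi> k. trop (P $ k))"
    unfolding tropical_singularities_def by blast
  then have "p \<in> rational_points" by (simp add: rational_points_def trop_def)
  moreover have "p \<in> real_trop_hypersurface (euler_derivative L f)" if "L \<noteq> 0" for L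
    using assms(2) that FP by (rule singular_zero_imp_mem_euler_derivative)
  ultimately show "p \<in> (\<Inter>L\<in>{L. L \<noteq> 0}. real_trop_hypersurface (euler_derivative L f)) \<inter> rational_points"
    by blast
next
  fix p assume "p \<in> (\<Inter>L\<in>{L. L \<noteq> 0}. real_trop_hypersurface (euler_derivative L f)) \<inter> rational_points"
  then have p: "p \<in> rational_points" "\<And>L. L \<noteq> 0 \<Longrightarrow> p \<in> real_trop_hypersurface (euler_derivative L f)"
    by auto
  have "p \<in> real_trop_hypersurface f"
    using p(2)[of "(1, 0)"] by (simp add: euler_derivative_1 prod_eq_iff)
  moreover obtain F P where "is_singular_zero F P" "trop_of_poly F = f" "\<forall>k. P $ k \<noteq> 0"
      "p = (\<chi> k. trop (P $ k))"
    using assms(1,3) p by (rule mem_euler_derivatives_lift)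
  ultimately show "p \<in> tropical_singularities f"
    unfolding tropical_singularities_def by blast
qed

end
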